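(* Let $G^{A,B}$ be a biconed graph, and let $(h_0,h_1,\dots,h_d)$ be the $h$-vector of (the independence complex of) its graphic matroid $\mathcal{M}(G^{A,B})$, where $d=|V(G^{A,B})|-1$ is the rank. Then for every $0\le i\le d$, $h_i$ equals the number of $2$-weighted forests $(F,\omega)$ of $G^{A,B}_{\mathrm{red}}$ of degree $i$, where the degree of $(F,\omega)$ is $\sum_{e\in F}\omega(e)$.
   Context: Graphs are finite and undirected, possibly with loops and parallel edges. Biconed graph: let $G$ be a graph and $A,B\subseteq V(G)$ (not necessarily disjoint) with $A\cup B=V(G)$. The biconing $G^{A,B}$ of $G$ is obtained by adding two new vertices $0$ and $\overline{0}$ and the edges $0\overline{0}$, $0a$ for all $a\in A$, and $\overline{0}b$ for all $b\in B$. A biconed graph is any graph so obtained (with this data). Put $\overline{A}:=B\setminus A$, so $V(G)=A\sqcup\overline{A}$. Let $T_0$ be the spanning tree of $G^{A,B}$ with edges $0\overline{0}$, $0u$ ($u\in A$) and $\overline{0}v$ ($v\in\overline{A}$). Let $G^{A,B}_{\mathrm{red}}$ be the graph obtained from $G^{A,B}$ by deleting the edges of $T_0$ and the vertex $0$ (so its vertex set is $V(G)\cup\{\overline{0}\}$). Weighted forests: for a set $F\subseteq E(G^{A,B}_{\mathrm{red}})$ with a weighting $\omega:F\to\mathbb{N}_{\ge 1}$, regard $F$ as a spanning subgraph of $G^{A,B}_{\mathrm{red}}$ (all vertices included, isolated vertices being components). The excess weight of a connected component $S$ is $\delta_{\overline{0}\in S}+\sum_{e\in S}(\omega(e)-1)$,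 where $\delta_{\overline{0}\in S}$ is $1$ if $\overline{0}$ is a vertex of $S$ and $0$ otherwise. An edge $e\in F$ is called a weighted edge if $\omega(e)\ge 2$. An edge of $G^{A,B}_{\mathrm{red}}$ is crossing if it joins a vertex of $A$ to a vertex of $\overline{A}\cup\{\overline{0}\}$. A $2$-weighted forest of $G^{A,B}_{\mathrm{red}}$ is such a pair $(F,\omega)$ satisfying: (C0) $F$ is acyclic; (C1) at most one component has excess weight $2$; (C2) every other component has excess weight $0$ or $1$; (C3) in a component of excess weight $2$ not containing $\overline{0}$, the number of crossing edges in the unique shortest path containing all weighted edges of the component is odd; in a component of excess weight $2$ containing $\overline{0}$, the number of crossing edges in the shortest path containing both the weighted edge and $\overline{0}$ is odd. The empty set $F=\varnothing$ is allowed. $h$-vector: for a matroid of rank $d$, let $f_{i-1}$ be the number of independent sets of size $i$; the $h$-vector $(h_0,\dots,h_d)$ is defined by $\sum_{i=0}^d f_{i-1}(t-1)^{d-i}=\sum_{k=0}^d h_k t^{d-k}$. The graphic matroid $\mathcal{M}(H)$ of a graph $H$ has ground set $E(H)$ and independent sets the acyclic edge sets. *)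

theory Defs
  imports "HOL-Library.FuncSet" "HOL-Computational_Algebra.Polynomial"
begin

section \<open>Finite undirected multigraphs\<close>

text \<open>The ends of an edge form a set of one (loop) or two vertices; parallel edges are distinct
  elements of type 'e with the same set of ends.\<close>

record ('v, 'e) multigraph =
  verts :: "'v set"
  edges :: "'e set"
  ends :: "'e \<Rightarrow> 'v set"

definition finite_multigraph :: "('v, 'e) multigraph \<Rightarrow> bool" where
  "finite_multigraph H \<longleftrightarrow> finite (verts H) \<and> finite (edges H) \<and>
     (\<forall>e\<in>edges H. ends H e \<subseteq> verts H \<and> card (ends H e) \<in> {1, 2})"

definition delete_edges :: "('v, 'e) multigraph \<Rightarrow> 'e set \<Rightarrow> ('v, 'e) multigraph" where
  "delete_edges H T = H\<lparr>edges := edges H - T\<rparr>"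

definition delete_vertex :: "('v, 'e) multigraph \<Rightarrow> 'v \<Rightarrow> ('v, 'e) multigraph" where
  "delete_vertex H x = H\<lparr>verts := verts H - {x}, edges := {e \<in> edges H. x \<notin> ends H e}\<rparr>"

text \<open>A cycle of length 1 is a loop, one of length 2 is a pair of distinct parallel edges.\<close>

definition is_cycle :: "('v, 'e) multigraph \<Rightarrow> 'v list \<Rightarrow> 'e list \<Rightarrow> bool" where
  "is_cycle H vs es \<longleftrightarrow> es \<noteq> [] \<and> length vs = length es \<and> distinct vs \<and> distinct es \<and>
     set vs \<subseteq> verts H \<and> set es \<subseteq> edges H \<and>
     (\<forall>i<length es. ends H (es ! i) = {vs ! i, vs ! (Suc i mod length vs)})"

definition acyclic_edges :: "('v, 'e) multigraph \<Rightarrow> 'e set \<Rightarrow> bool" where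
  "acyclic_edges H F \<longleftrightarrow> \<not> (\<exists>vs es. is_cycle H vs es \<and> set es \<subseteq> F)"

definition is_path :: "('v, 'e) multigraph \<Rightarrow> 'e set \<Rightarrow> 'v list \<Rightarrow> 'e list \<Rightarrow> bool" where
  "is_path H F vs es \<longleftrightarrow> length vs = Suc (length es) \<and> distinct vs \<and>
     set vs \<subseteq> verts H \<and> set es \<subseteq> F \<and>
     (\<forall>i<length es. ends H (es ! i) = {vs ! i, vs ! Suc i})"

definition adjacency :: "('v, 'e) multigraph \<Rightarrow> 'e set \<Rightarrow> 'v rel" where
  "adjacency H F = {(u, v). \<exists>e\<in>F. ends H e = {u, v}}"

text \<open>Vertex sets of the connected components of the spanning subgraph of H with edge set F.\<close>

definition components :: "('v, 'e) multigraph \<Rightarrow> 'e set \<Rightarrow> 'v set set" where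
  "components H F = verts H // (adjacency H F)\<^sup>*"

definition component_edges :: "('v, 'e) multigraph \<Rightarrow> 'e set \<Rightarrow> 'v set \<Rightarrow> 'e set" where
  "component_edges H F S = {e \<in> F. ends H e \<subseteq> S}"


section \<open>The graphic matroid and h-vectors\<close>

text \<open>A matroid is represented by its independence complex, i.e. its set of independent sets.\<close>

definition graphic_matroid :: "('v, 'e) multigraph \<Rightarrow> 'e set set" where
  "graphic_matroid H = {F. F \<subseteq> edges H \<and> acyclic_edges H F}"

definition matroid_rank :: "'e set set \<Rightarrow> nat" where
  "matroid_rank M = Max (card ` M)"

text \<open>With the usual indexing of f-vectors by dimension, the following is $f_{i-1}$.\<close>

definition num_indep :: "'e set set \<Rightarrow> nat \<Rightarrow> nat" where
  "num_indep M i = card {F \<in> M. card F = i}"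

definition h_polynomial :: "'e set set \<Rightarrow> int poly" where
  "h_polynomial M = (\<Sum>i\<le>matroid_rank M.
     of_nat (num_indep M i) * (monom 1 1 - 1) ^ (matroid_rank M - i))"

definition h_vector :: "'e set set \<Rightarrow> nat \<Rightarrow> int" where
  "h_vector M k = coeff (h_polynomial M) (matroid_rank M - k)"

lemma h_vector_defining_equation:
  "(\<Sum>i\<le>matroid_rank M. of_nat (num_indep M i) * (monom 1 1 - 1) ^ (matroid_rank M - i)) =
   (\<Sum>k\<le>matroid_rank M. monom (h_vector M k) (matroid_rank M - k))"
proof -
  let ?d = "matroid_rank M"
  have X: "degree (monom 1 1 - 1 :: int poly) \<le> 1"
    by (intro degree_diff_le) (auto simp: degree_monom_eq)
  have "degree (of_nat (num_indep M i) * (monom 1 1 - 1 :: int poly) ^ (?d - i)) \<le> ?d" for i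
  proof -
    have "degree (of_nat (num_indep M i) * (monom 1 1 - 1 :: int poly) ^ (?d - i))
        \<le> degree ((monom 1 1 - 1 :: int poly) ^ (?d - i))"
      using degree_mult_le[of "of_nat (num_indep M i)" "(monom 1 1 - 1 :: int poly) ^ (?d - i)"]
      by simp
    also have "\<dots> \<le> degree (monom 1 1 - 1 :: int poly) * (?d - i)"
      by (rule degree_power_le)
    also have "\<dots> \<le> 1 * (?d - i)"
      using X by (rule mult_right_mono) simp
    finally show ?thesis by simp
  qed
  then have "degree (h_polynomial M) \<le> ?d"
    unfolding h_polynomial_def by (intro degree_sum_le) auto
  then have "h_polynomial M = (\<Sum>j\<le>?d. monom (coeff (h_polynomial M) j) j)"
    by (simp add: poly_as_sum_of_monoms')
  also have "\<dots> = (\<Sum>k\<le>?d. monom (h_vector M k) (?d - k))"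
    unfolding h_vector_def
    by (rule sum.reindex_bij_witness[of _ "\<lambda>k. ?d - k" "\<lambda>k. ?d - k"]) auto
  finally show ?thesis by (simp add: h_polynomial_def)
qed


section \<open>Biconed graphs\<close>

text \<open>\<open>Zero\<close> and \<open>ZeroBar\<close> are the two added vertices $0$ and $\overline{0}$. The added edges are
  \<open>ConeEdge\<close> (joining $0$ and $\overline{0}$), \<open>EdgeA a\<close> (joining $0$ and $a \in A$) and
  \<open>EdgeB b\<close> (joining $\overline{0}$ and $b \in B$).\<close>

datatype 'v bicone_vertex = Zero | ZeroBar | Vertex 'v

datatype ('v, 'e) bicone_edge = ConeEdge | EdgeA 'v | EdgeB 'v | Edge 'e

fun bicone_ends :: "('v, 'e) multigraph \<Rightarrow> ('v, 'e) bicone_edge \<Rightarrow> 'v bicone_vertex set" where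
  "bicone_ends G ConeEdge = {Zero, ZeroBar}"
| "bicone_ends G (EdgeA a) = {Zero, Vertex a}"
| "bicone_ends G (EdgeB b) = {ZeroBar, Vertex b}"
| "bicone_ends G (Edge e) = Vertex ` ends G e"

definition biconing ::
  "('v, 'e) multigraph \<Rightarrow> 'v set \<Rightarrow> 'v set \<Rightarrow> ('v bicone_vertex, ('v, 'e) bicone_edge) multigraph" where
  "biconing G A B =
     \<lparr>verts = {Zero, ZeroBar} \<union> Vertex ` verts G,
      edges = {ConeEdge} \<union> EdgeA ` A \<union> EdgeB ` B \<union> Edge ` edges G,
      ends = bicone_ends G\<rparr>"

definition tree0 :: "'v set \<Rightarrow> 'v set \<Rightarrow> ('v, 'e) bicone_edge set" where
  "tree0 A B = {ConeEdge} \<union> EdgeA ` A \<union> EdgeB ` (B - A)"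

definition reduced_biconing ::
  "('v, 'e) multigraph \<Rightarrow> 'v set \<Rightarrow> 'v set \<Rightarrow> ('v bicone_vertex, ('v, 'e) bicone_edge) multigraph" where
  "reduced_biconing G A B = delete_vertex (delete_edges (biconing G A B) (tree0 A B)) Zero"

definition crossing ::
  "('v, 'e) multigraph \<Rightarrow> 'v set \<Rightarrow> 'v set \<Rightarrow> ('v, 'e) bicone_edge \<Rightarrow> bool" where
  "crossing G A B e \<longleftrightarrow>
     (\<exists>x \<in> Vertex ` A. \<exists>y \<in> Vertex ` (B - A) \<union> {ZeroBar}.
        ends (reduced_biconing G A B) e = {x, y})"


section \<open>2-weighted forests\<close>

text \<open>The truncated subtraction is harmless, since weights are at least 1.\<close>

definition excess_weight ::
  "('v bicone_vertex, 'e) multigraph \<Rightarrow> 'e set \<Rightarrow> ('e \<Rightarrow> nat) \<Rightarrow> 'v bicone_vertex set \<Rightarrow> nat" where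
  "excess_weight H F w S =
     (if ZeroBar \<in> S then 1 else 0) + (\<Sum>e\<in>component_edges H F S. w e - 1)"

definition weighted_edges ::
  "('v, 'e) multigraph \<Rightarrow> 'e set \<Rightarrow> ('e \<Rightarrow> nat) \<Rightarrow> 'v set \<Rightarrow> 'e set" where
  "weighted_edges H F w S = {e \<in> component_edges H F S. w e \<ge> 2}"

text \<open>A path of minimal length in F containing the edge set W and the vertex set X. In a forest, if W
  or X is nonempty, such a path is unique up to reversal (when there is one), so that the edge
  set \<open>set es\<close> is determined.\<close>

definition shortest_path_containing ::
  "('v, 'e) multigraph \<Rightarrow> 'e set \<Rightarrow> 'e set \<Rightarrow> 'v set \<Rightarrow> 'v list \<Rightarrow> 'e list \<Rightarrow> bool" where
  "shortest_path_containing H F W X vs es \<longleftrightarrow>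
     is_path H F vs es \<and> W \<subseteq> set es \<and> X \<subseteq> set vs \<and>
     (\<forall>vs' es'. is_path H F vs' es' \<and> W \<subseteq> set es' \<and> X \<subseteq> set vs' \<longrightarrow> length es \<le> length es')"

text \<open>In the last clause, a component of excess weight 2 containing $\overline{0}$ has exactly one weighted
  edge, so that \<open>weighted_edges\<close> is the singleton of ``the weighted edge''.
  Weightings are extensional functions on F, so that each pair is counted once.\<close>

definition two_weighted_forest ::
  "('v, 'e) multigraph \<Rightarrow> 'v set \<Rightarrow> 'v set \<Rightarrow>
     ('v, 'e) bicone_edge set \<Rightarrow> (('v, 'e) bicone_edge \<Rightarrow> nat) \<Rightarrow> bool" where
  "two_weighted_forest G A B F w \<longleftrightarrow>
    (let H = reduced_biconing G A B; ex = excess_weight H F w in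
      F \<subseteq> edges H \<and> w \<in> F \<rightarrow>\<^sub>E {1..} \<and>
      acyclic_edges H F \<and>
      card {S \<in> components H F. ex S = 2} \<le> 1 \<and>
      (\<forall>S \<in> components H F. ex S \<noteq> 2 \<longrightarrow> ex S \<in> {0, 1}) \<and>
      (\<forall>S \<in> components H F. ex S = 2 \<and> ZeroBar \<notin> S \<longrightarrow>
         (\<exists>vs es. shortest_path_containing H F (weighted_edges H F w S) {} vs es \<and>
            odd (card {e \<in> set es. crossing G A B e}))) \<and>
      (\<forall>S \<in> components H F. ex S = 2 \<and> ZeroBar \<in> S \<longrightarrow>
         (\<exists>vs es. shortest_path_containing H F (weighted_edges H F w S) {ZeroBar} vs es \<and>
            odd (card {e \<in> set es. crossing G A B e}))))"

definition forest_degree :: "'e set \<Rightarrow> ('e \<Rightarrow> nat) \<Rightarrow> nat" where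
  "forest_degree F w = (\<Sum>e\<in>F. w e)"

end

theory Submission
  imports Defs
begin

text \<open>Every forest of the biconing splits as \<open>F \<union> X\<close> with \<open>F\<close> a forest of the reduced graph and \<open>X\<close> a set
  of edges of the tree \<open>T\<^sub>0\<close>. Fix \<open>F\<close>, let an ordinary component of \<open>F\<close> (one without \<open>ZeroBar\<close>) have \<open>n\<close>
  vertices, \<open>a\<close> of them in \<open>A\<close>, and let the component of \<open>ZeroBar\<close> have \<open>a\<^sub>0\<close> vertices in \<open>A\<close>. The edges of
  \<open>T\<^sub>0\<close> correspond to the vertices of the reduced graph, and \<open>F \<union> X\<close> is acyclic iff \<open>X\<close> has at most one
  edge at each ordinary component and none at the component of \<open>ZeroBar\<close>, except that at most one
  component may provide a link between \<open>Zero\<close> and \<open>ZeroBar\<close>: there are \<open>a(n - a)\<close> possible links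
  (of two edges) at an ordinary component and \<open>1 + a\<^sub>0\<close> (of one edge) at that of \<open>ZeroBar\<close>.

  The weightings of \<open>F\<close> have the same structure. An ordinary component has weight 1 everywhere, or
  weight 2 on one of its \<open>n - 1\<close> edges, and the component of \<open>ZeroBar\<close> has weight 1 everywhere, except
  that at most one component has excess weight 2. Distributing two extra units of weight over the edges of
  a tree amounts to choosing two distinct vertices, by taking the end edges of the path that joins
  them, and the parity condition says that exactly one of the two vertices lies in \<open>A\<close>. Hence an ordinary
  component has \<open>a(n - a)\<close> weightings of excess 2; that of \<open>ZeroBar\<close> has \<open>a\<^sub>0\<close>, one of the two vertices
  being \<open>ZeroBar\<close>.

  With \<open>s = t - 1\<close>, both sides of the claim, evaluated at \<open>t\<close>, are now sums over \<open>F\<close> with equal terms, because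
  \<open>s(1 + n/s) = t(1 + (n - 1)/t)\<close> and \<open>s(1 + (1 + a\<^sub>0)/s) = t(1 + a\<^sub>0/t)\<close>.\<close>

section \<open>Paths and bridges\<close>

abbreviation conn :: "('v, 'e) multigraph \<Rightarrow> 'e set \<Rightarrow> 'v \<Rightarrow> 'v \<Rightarrow> bool" where
  "conn H F u v \<equiv> (u, v) \<in> (adjacency H F)\<^sup>*"

lemma sym_adjacency: "sym (adjacency H F)"
  by (auto simp: sym_def adjacency_def insert_commute)

lemma conn_sym: "conn H F u v \<Longrightarrow> conn H F v u"
  by (meson sym_adjacency sym_rtrancl symD)

lemma conn_mono: "conn H F u v \<Longrightarrow> F \<subseteq> F' \<Longrightarrow> conn H F' u v"
  by (erule rtrancl_mono[THEN subsetD, rotated]) (auto simp: adjacency_def)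

lemma conn_edge: "e \<in> F \<Longrightarrow> ends H e = {u, v} \<Longrightarrow> conn H F u v"
  by (rule r_into_rtrancl) (auto simp: adjacency_def)

text \<open>Connections are refuted through this rule: a set that is closed along the edges of
  \<open>F\<close> contains everything reachable from its elements.\<close>

lemma conn_closed:
  assumes "conn H F u v" "u \<in> X"
    and "\<And>e x y. e \<in> F \<Longrightarrow> ends H e = {x, y} \<Longrightarrow> x \<in> X \<Longrightarrow> y \<in> X"
  shows "v \<in> X"
  using assms(1,2) by (induction rule: rtrancl_induct) (auto simp: adjacency_def intro: assms(3))

lemma edge_ends:
  assumes "finite_multigraph H" "e \<in> edges H"
  obtains u v where "ends H e = {u, v}" "u \<in> verts H" "v \<in> verts H"
proof -
  have "card (ends H e) = 1 \<or> card (ends H e) = 2" "ends H e \<subseteq> verts H"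
    using assms by (auto simp: finite_multigraph_def)
  then show ?thesis using that by (fastforce simp: card_1_singleton_iff card_2_iff)
qed

lemma conn_verts:
  assumes "finite_multigraph H" "F \<subseteq> edges H" "conn H F u v" "u \<in> verts H"
  shows "v \<in> verts H"
  by (rule conn_closed[OF assms(3,4)])
    (metis assms(1,2) finite_multigraph_def insert_subset subsetD)

section \<open>Paths as pairs of lists, and reachability\<close>

lemma is_path_Nil: "is_path H F vs [] \<longleftrightarrow> (\<exists>u\<in>verts H. vs = [u])"
  by (auto simp: is_path_def length_Suc_conv)

text \<open>Turns the index-based definition of a path into a recursion on both lists, which the
  inductions below follow.\<close>

lemma is_path_Cons:
  "is_path H F (u # vs) (e # es) \<longleftrightarrow> u \<in> verts H \<and> u \<notin> set vs \<and> e \<in> F \<and>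
     ends H e = {u, hd vs} \<and> is_path H F vs es"
proof (cases vs)
  case (Cons v vs')
  show ?thesis
    unfolding is_path_def Cons by (auto simp: All_less_Suc2)
qed (auto simp: is_path_def)

lemma is_path_ConsE:
  assumes "is_path H F vs (e # es)"
  obtains u us where "vs = u # us" "u \<in> verts H" "u \<notin> set us" "e \<in> F"
    "ends H e = {u, hd us}" "is_path H F us es"
  using assms by (cases vs) (auto simp: is_path_Cons, auto simp: is_path_def)

lemma is_path_ConsD:
  assumes "is_path H F vs (e # es)"
  shows "ends H e = {hd vs, hd (tl vs)}" "is_path H F (tl vs) es" "hd vs \<notin> set (tl vs)" "e \<in> F"
  using assms by (auto elim: is_path_ConsE)

lemma is_path_nonempty: "is_path H F vs es \<Longrightarrow> vs \<noteq> []"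
  by (auto simp: is_path_def)

lemma is_path_hd_last_in:
  "is_path H F vs es \<Longrightarrow> hd vs \<in> set vs" "is_path H F vs es \<Longrightarrow> last vs \<in> set vs"
  by (simp_all add: is_path_nonempty)

lemma is_path_rev:
  assumes "is_path H F vs es"
  shows "is_path H F (rev vs) (rev es)"
proof -
  have l: "length vs = Suc (length es)" using assms by (simp add: is_path_def)
  have "ends H (rev es ! i) = {rev vs ! i, rev vs ! Suc i}" if "i < length es" for i
  proof -
    have "ends H (es ! (length es - Suc i)) =
        {vs ! (length es - Suc i), vs ! Suc (length es - Suc i)}"
      using assms that by (simp add: is_path_def)
    moreover have "Suc (length es - Suc i) = length es - i" using that by simp
    ultimately show ?thesis using that l by (simp add: rev_nth insert_commute)
  qed
  then show ?thesis using assms by (auto simp: is_path_def)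
qed

lemma is_path_ends_subset: "is_path H F vs es \<Longrightarrow> e \<in> set es \<Longrightarrow> ends H e \<subseteq> set vs"
proof -
  assume p: "is_path H F vs es" "e \<in> set es"
  then obtain i where i: "i < length es" "e = es ! i" by (auto simp: in_set_conv_nth)
  then have "vs ! i \<in> set vs" "vs ! Suc i \<in> set vs" using p by (auto simp: is_path_def)
  then show ?thesis using i p by (simp add: is_path_def)
qed

text \<open>If the first edge occurred again, its ends would lie on the rest of the path, but the
  first vertex does not.\<close>

lemma is_path_distinct_edges: "is_path H F vs es \<Longrightarrow> distinct es"
proof (induction es arbitrary: vs)
  case (Cons e es)
  then show ?case
    by (elim is_path_ConsE) (auto dest: is_path_ends_subset)
qed simp

lemma is_path_conn: "is_path H F vs es \<Longrightarrow> x \<in> set vs \<Longrightarrow> conn H (set es) (hd vs) x"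
proof (induction es arbitrary: vs)
  case (Cons e es)
  then obtain u us where us: "vs = u # us" "ends H e = {u, hd us}" "is_path H F us es"
    by (elim is_path_ConsE) auto
  show ?case
  proof (cases "x = u")
    case False
    then have "conn H (set es) (hd us) x" using Cons us by auto
    then have "conn H (set (e # es)) (hd us) x" by (rule conn_mono) auto
    moreover have "conn H (set (e # es)) u (hd us)" using us by (intro conn_edge) auto
    ultimately show ?thesis using us by auto
  qed (use us in auto)
qed (auto simp: is_path_Nil)

lemma is_path_conn': "is_path H F vs es \<Longrightarrow> x \<in> set vs \<Longrightarrow> y \<in> set vs \<Longrightarrow> conn H F x y"
proof -
  assume p: "is_path H F vs es" "x \<in> set vs" "y \<in> set vs"
  have "set es \<subseteq> F" using p by (auto simp: is_path_def)
  then show ?thesis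
    using is_path_conn[OF p(1,2)] is_path_conn[OF p(1,3)] conn_sym conn_mono
    by (metis rtrancl_trans)
qed

text \<open>Shortens a walk that returns to a vertex \<open>x\<close>: everything before
  \<open>x\<close> is cut off.\<close>

lemma is_path_suffix:
  "is_path H F vs es \<Longrightarrow> x \<in> set vs \<Longrightarrow>
     \<exists>vs' es'. is_path H F vs' es' \<and> hd vs' = x \<and> last vs' = last vs"
proof (induction es arbitrary: vs)
  case Nil
  then show ?case by (intro exI[of _ vs] exI[of _ "[]"]) (auto simp: is_path_Nil)
next
  case (Cons e es)
  then obtain u us where us: "vs = u # us" "is_path H F us es"
    by (elim is_path_ConsE) auto
  show ?case
  proof (cases "x = u")
    case True
    then show ?thesis using Cons us by (metis list.sel(1))
  next
    case False
    then show ?thesis using Cons us is_path_nonempty by fastforce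
  qed
qed

text \<open>A new vertex put in front either extends the path or already lies on it; in the second
  case a suffix is taken.\<close>

lemma conn_path:
  assumes H: "finite_multigraph H" "F \<subseteq> edges H" and "u \<in> verts H" "conn H F u v"
  obtains vs es where "is_path H F vs es" "hd vs = u" "last vs = v"
proof -
  have "u \<in> verts H \<longrightarrow> (\<exists>vs es. is_path H F vs es \<and> hd vs = u \<and> last vs = v)"
    using assms(4)
  proof (induction rule: converse_rtrancl_induct)
    case base
    show ?case by (metis is_path_Nil last.simps list.sel(1))
  next
    case (step x y)
    then obtain e where e: "e \<in> F" "ends H e = {x, y}" by (auto simp: adjacency_def)
    show ?case
    proof
      assume x: "x \<in> verts H"
      then have "y \<in> verts H" using H conn_verts step(1) by (metis r_into_rtrancl)
      then obtain vs es where p: "is_path H F vs es" "hd vs = y" "last vs = v"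
        using step by auto
      show "\<exists>vs es. is_path H F vs es \<and> hd vs = x \<and> last vs = v"
      proof (cases "x \<in> set vs")
        case True
        then show ?thesis using is_path_suffix[OF p(1)] p(3) by auto
      next
        case False
        then have "is_path H F (x # vs) (e # es)" using p e x by (simp add: is_path_Cons)
        then show ?thesis using p is_path_nonempty[OF p(1)] by (metis last_ConsR list.sel(1))
      qed
    qed
  qed
  then show ?thesis using that assms by blast
qed

section \<open>Cycles and bridges\<close>

lemma acyclic_edges_mono: "acyclic_edges H F \<Longrightarrow> F' \<subseteq> F \<Longrightarrow> acyclic_edges H F'"
  unfolding acyclic_edges_def by blast

text \<open>A path from \<open>u\<close> to \<open>v\<close> that avoids \<open>e\<close> is closed
  to a cycle by \<open>e\<close>. If \<open>e\<close> is a loop, the path is trivial and the cycle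
  has length 1.\<close>

lemma acyclic_edges_bridge:
  assumes "finite_multigraph H" "F \<subseteq> edges H" "acyclic_edges H F" "e \<in> F" "ends H e = {u, v}"
  shows "\<not> conn H (F - {e}) u v"
proof
  assume c: "conn H (F - {e}) u v"
  have "u \<in> verts H" using assms unfolding finite_multigraph_def by (metis insert_subset subsetD)
  then obtain vs es where p: "is_path H (F - {e}) vs es" "hd vs = u" "last vs = v"
    using conn_path[OF assms(1) _ _ c] assms(2) by blast
  have l: "length vs = Suc (length es)" "distinct vs" "set vs \<subseteq> verts H" "set es \<subseteq> F - {e}"
    "\<forall>i<length es. ends H (es ! i) = {vs ! i, vs ! Suc i}"
    using p by (auto simp: is_path_def)
  have "is_cycle H vs (es @ [e])"
    unfolding is_cycle_def
  proof (intro conjI allI impI)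
    fix i assume i: "i < length (es @ [e])"
    show "ends H ((es @ [e]) ! i) = {vs ! i, vs ! (Suc i mod length vs)}"
    proof (cases "i < length es")
      case True
      then show ?thesis using l by (simp add: nth_append)
    next
      case False
      then have "i = length es" using i by simp
      \<comment> \<open>The closing edge \<open>e\<close> joins the last vertex \<open>v\<close> to
        the first one \<open>u\<close>, since the index is taken modulo the length.\<close>
      moreover have "vs ! 0 = u" "vs ! length es = v"
        using p l by (auto simp: hd_conv_nth last_conv_nth is_path_nonempty)
      ultimately show ?thesis using assms l by auto
    qed
  qed (use l is_path_distinct_edges[OF p(1)] assms in auto)
  moreover have "set (es @ [e]) \<subseteq> F" using l assms by auto
  ultimately show False using assms unfolding acyclic_edges_def by blast
qed

text \<open>The ends of an edge of a cycle stay connected without it, by going round the cycle the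
  other way.\<close>

lemma cycle_conn:
  assumes c: "is_cycle H vs es" "set es \<subseteq> F" and e: "e \<in> set es"
  obtains u v where "ends H e = {u, v}" "conn H (F - {e}) u v"
proof -
  define n where "n = length es"
  obtain k where k: "k < n" "es ! k = e" using e by (auto simp: in_set_conv_nth n_def)
  have c': "length vs = n" "distinct es" "set es \<subseteq> edges H"
    "\<And>i. i < n \<Longrightarrow> ends H (es ! i) = {vs ! i, vs ! (Suc i mod n)}"
    using c by (auto simp: is_cycle_def n_def)
  \<comment> \<open>The walk starts just behind \<open>e\<close>, which has index \<open>k\<close>.
    It would have to make \<open>n\<close> steps to use \<open>e\<close>, so \<open>n - 1\<close>
    steps lead to the other end of \<open>e\<close> and avoid it.\<close>
  have "j < n \<Longrightarrow> conn H (F - {e}) (vs ! (Suc k mod n)) (vs ! ((Suc k + j) mod n))" for j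
  proof (induction j)
    case (Suc j)
    let ?i = "(Suc k + j) mod n"
    have i: "?i < n" using k by simp
    have "?i \<noteq> k"
    proof
      assume "?i = k"
      then have "(k + Suc j) mod n = (k + 0) mod n" using k by simp
      then have "Suc j mod n = 0"
        by (metis add_diff_cancel_left' k(1) le_add1 mod_eq_dvd_iff_nat mod_0_imp_dvd
            diff_zero add_0_right dvd_imp_mod_0)
      then show False using Suc by simp
    qed
    then have "es ! ?i \<noteq> e" using c' k i by (metis n_def nth_eq_iff_index_eq)
    then have "es ! ?i \<in> F - {e}" using c i by (auto simp: n_def)
    moreover have "ends H (es ! ?i) = {vs ! ?i, vs ! ((Suc k + Suc j) mod n)}"
      using c'(4)[OF i] by (simp add: mod_Suc_eq)
    ultimately have "conn H (F - {e}) (vs ! ?i) (vs ! ((Suc k + Suc j) mod n))"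
      by (rule conn_edge)
    then show ?case using Suc by (meson Suc_lessD rtrancl_trans)
  qed simp
  from this[of "n - 1"] have "conn H (F - {e}) (vs ! (Suc k mod n)) (vs ! k)"
    using k by (simp add: mod_add_self2)
  then show ?thesis using c'(4)[OF k(1)] k that conn_sym by metis
qed

text \<open>A cycle in \<open>F \<union> S\<close> that is not contained in the forest
  \<open>F\<close> has an edge in \<open>S\<close>, and this edge is no bridge. So only the edges of
  \<open>S\<close> need to be tested.\<close>

lemma acyclic_edges_Un_iff:
  assumes "finite_multigraph H" "F \<subseteq> edges H" "S \<subseteq> edges H"
  shows "acyclic_edges H (F \<union> S) \<longleftrightarrow> acyclic_edges H F \<and>
    (\<forall>e\<in>S. \<forall>u v. ends H e = {u, v} \<longrightarrow> \<not> conn H (F \<union> S - {e}) u v)"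
proof safe
  assume "acyclic_edges H F" and
    b: "\<forall>e\<in>S. \<forall>u v. ends H e = {u, v} \<longrightarrow> \<not> conn H (F \<union> S - {e}) u v"
  show "acyclic_edges H (F \<union> S)"
    unfolding acyclic_edges_def
  proof safe
    fix vs es assume c: "is_cycle H vs es" "set es \<subseteq> F \<union> S"
    then obtain e where "e \<in> set es" "e \<notin> F"
      using \<open>acyclic_edges H F\<close> unfolding acyclic_edges_def by blast
    then show False using cycle_conn[OF c] b c(2) by (metis Un_iff subsetD)
  qed
next
  fix e u v
  assume "acyclic_edges H (F \<union> S)" "e \<in> S" "ends H e = {u, v}" "conn H (F \<union> S - {e}) u v"
  then show False using acyclic_edges_bridge[of H "F \<union> S" e u v] assms by auto
qed (auto intro: acyclic_edges_mono)

section \<open>Uniqueness of paths in a forest\<close>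

locale forest =
  fixes H :: "('v, 'e) multigraph" and F :: "'e set"
  assumes finite_multigraph: "finite_multigraph H"
    and edges: "F \<subseteq> edges H"
    and acyclic: "acyclic_edges H F"
begin

lemma bridge: "e \<in> F \<Longrightarrow> ends H e = {u, v} \<Longrightarrow> \<not> conn H (F - {e}) u v"
  using acyclic_edges_bridge finite_multigraph edges acyclic by metis

text \<open>The rest of the path survives the removal of its first edge, and this edge is a bridge.
  This tells which end of \<open>e\<close> is the start of the path.\<close>

lemma path_head_cut:
  assumes "is_path H F vs (e # es)" "x \<in> set (tl vs)"
  shows "conn H (F - {e}) (hd (tl vs)) x" "\<not> conn H (F - {e}) (hd vs) x"
proof -
  obtain u us where us: "vs = u # us" "e \<in> F" "ends H e = {u, hd us}" "is_path H F us es"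
    using assms by (elim is_path_ConsE)
  have "e \<notin> set es" "set es \<subseteq> F"
    using is_path_distinct_edges[OF assms(1)] assms(1) by (auto simp: is_path_def)
  then have c: "conn H (F - {e}) (hd us) y" if "y \<in> set us" for y
    using is_path_conn[OF us(4) that] by (rule_tac conn_mono) auto
  from c show "conn H (F - {e}) (hd (tl vs)) x" using assms us by simp
  show "\<not> conn H (F - {e}) (hd vs) x"
    using bridge[OF us(2,3)] c assms us by (metis conn_sym list.sel(1,3) rtrancl_trans)
qed

lemma path_unique:
  "is_path H F vs es \<Longrightarrow> is_path H F vs' es' \<Longrightarrow> hd vs = hd vs' \<Longrightarrow> last vs = last vs' \<Longrightarrow>
     vs = vs' \<and> es = es'"
proof (induction es arbitrary: vs vs' es')
  case Nil
  then obtain u where u: "vs = [u]" by (auto simp: is_path_Nil)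
  show ?case
  proof (cases es')
    case (Cons e es)
    obtain us where us: "vs' = u # us" "u \<notin> set us" "is_path H F us es"
      using Nil.prems(2,3) u unfolding Cons by (elim is_path_ConsE) auto
    then have "us \<noteq> []" using is_path_nonempty by metis
    then have "last us = u" using Nil.prems(4) u us by simp
    then show ?thesis using us(2) \<open>us \<noteq> []\<close> last_in_set by metis
  qed (use Nil u in \<open>auto simp: is_path_Nil\<close>)
next
  case (Cons e es)
  obtain u us where us: "vs = u # us" "u \<notin> set us" "e \<in> F" "ends H e = {u, hd us}"
    "is_path H F us es"
    using Cons.prems(1) by (elim is_path_ConsE)
  have ne: "us \<noteq> []" using us is_path_nonempty by metis
  show ?case
  proof (cases es')
    case Nil
    then show ?thesis using Cons.prems us ne by (auto simp: is_path_Nil)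
  next
    case es': (Cons e' es'')
    obtain us' where us': "vs' = u # us'" "u \<notin> set us'" "e' \<in> F" "ends H e' = {u, hd us'}"
      "is_path H F us' es''"
      using is_path_ConsE[OF Cons.prems(2)[unfolded es']] Cons.prems(3) us(1) by (metis list.sel(1))
    have ne': "us' \<noteq> []" using us' is_path_nonempty by metis
    have l: "last us = last us'" using Cons.prems us us' ne ne' by simp
    have "e = e'"
    proof (rule ccontr)
      \<comment> \<open>The second path leaves \<open>u\<close> by another edge and never returns to
        \<open>u\<close>, so it avoids \<open>e\<close>. But \<open>e\<close> separates
        \<open>u\<close> from the common last vertex.\<close>
      assume "e \<noteq> e'"
      have "e \<notin> set es''" using is_path_ends_subset[OF us'(5)] us us' by auto
      then have "e \<notin> set es'" using es' \<open>e \<noteq> e'\<close> by simp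
      moreover have "set es' \<subseteq> F" using Cons.prems by (auto simp: is_path_def)
      moreover have "conn H (set es') u (last us)"
        using is_path_conn[OF Cons.prems(2)] us' ne' l by simp
      ultimately have "conn H (F - {e}) u (last us)" by (rule_tac conn_mono) auto
      then show False using path_head_cut(2)[OF Cons.prems(1), of "last us"] us ne by simp
    qed
    moreover have "hd us = hd us'"
      using us us' ne ne' \<open>e = e'\<close> hd_in_set[of us] hd_in_set[of us'] by (auto simp: doubleton_eq_iff)
    ultimately show ?thesis using Cons.IH[OF us(5) us'(5)] l us us' es' by simp
  qed
qed

text \<open>The first vertex of a path is the end of its first edge e that the removal of e separates
  from the rest of the path.\<close>

lemma path_hd_unique:
  assumes p: "is_path H F vs (e # es)" "is_path H F vs' (e # es')"
    and x: "x \<in> set (tl vs)" "x \<in> set (tl vs')"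
  shows "hd vs = hd vs'"
proof (rule ccontr)
  assume ne: "hd vs \<noteq> hd vs'"
  have "ends H e = {hd vs, hd (tl vs)}" "ends H e = {hd vs', hd (tl vs')}"
    using p is_path_ConsD(1) by metis+
  then have "hd vs = hd (tl vs')" using ne by (auto simp: doubleton_eq_iff)
  then show False using path_head_cut(1)[OF p(2) x(2)] path_head_cut(2)[OF p(1) x(1)] by simp
qed

text \<open>If the first and the last edge coincide, the path is that single edge; its direction is
  then undetermined, hence the unordered pairs. Otherwise the last edge provides a vertex common to
  both tails, which determines the first vertex, and reversal gives the last one.\<close>

lemma path_end_edges_unique:
  assumes p: "is_path H F vs es" "is_path H F vs' es'" and ne: "es \<noteq> []" "es' \<noteq> []"
    and eq: "hd es = hd es'" "last es = last es'"
  shows "{hd vs, last vs} = {hd vs', last vs'}"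
proof (cases "hd es = last es")
  case True
  have *: "ends H (hd fs) = {hd us, last us}"
    if q: "is_path H F us fs" "fs \<noteq> []" "hd fs = last fs" for us fs
  proof -
    obtain f gs where fs: "fs = f # gs" using q(2) by (cases fs) auto
    have "gs = []"
      using is_path_distinct_edges[OF q(1)] q(3) fs last_in_set[of gs] by (auto split: if_splits)
    then obtain u where "tl us = [u]" using is_path_ConsD(2)[of H F us f gs] q fs by (auto simp: is_path_Nil)
    moreover have "last us = last (tl us)"
      using calculation is_path_nonempty[OF q(1)] by (cases us) auto
    ultimately show ?thesis using is_path_ConsD(1)[of H F us f gs] q fs by simp
  qed
  show ?thesis using *[OF p(1) ne(1)] *[OF p(2) ne(2)] True eq by simp
next
  case False
  have *: "hd us = hd us'"
    if p: "is_path H F us fs" "is_path H F us' fs'" and ne: "fs \<noteq> []" "fs' \<noteq> []"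
      and eq: "hd fs = hd fs'" "last fs = last fs'" "hd fs \<noteq> last fs" for us us' fs fs'
  proof -
    \<comment> \<open>A last edge that differs from the first one lies behind it, so its ends are on
      the tail of the path.\<close>
    have **: "\<exists>gs. ws = e # gs \<and> ends H f \<subseteq> set (tl xs)"
      if q: "is_path H F xs ws" "hd ws = e" "last ws = f" "ws \<noteq> []" "e \<noteq> f" for xs ws e f
    proof -
      obtain gs where gs: "ws = e # gs" using q by (cases ws) auto
      then have "f \<in> set gs" using q by (auto split: if_splits)
      then show ?thesis 
        using gs is_path_ends_subset is_path_ConsD(2)[of H F xs e gs] q(1) by metis
    qed
    obtain x where "x \<in> ends H (last fs)"
      using edge_ends[OF finite_multigraph] p(1) ne edges
      by (metis insertI1 is_path_def last_in_set subsetD)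
    moreover obtain gs where gs: "fs = hd fs # gs" "ends H (last fs) \<subseteq> set (tl us)"
      using **[OF p(1) refl refl ne(1) eq(3)] by auto
    moreover obtain gs' where gs': "fs' = hd fs # gs'" "ends H (last fs) \<subseteq> set (tl us')"
      using **[OF p(2) refl refl ne(2)] eq by auto
    moreover have "is_path H F us (hd fs # gs)" "is_path H F us' (hd fs # gs')"
      using p gs(1) gs'(1) by metis+
    ultimately show ?thesis using path_hd_unique[of us "hd fs" gs us' gs' x] by blast
  qed
  have "hd vs = hd vs'" using *[OF p ne eq False] .
  moreover have "last vs = last vs'"
    using *[OF is_path_rev[OF p(1)] is_path_rev[OF p(2)]] ne eq False
    by (simp add: hd_rev last_rev)
  ultimately show ?thesis by simp
qed

lemma path_end_edges_unique':
  assumes p: "is_path H F vs es" "is_path H F vs' es'" and ne: "es \<noteq> []" "es' \<noteq> []"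
    and eq: "{hd es, last es} = {hd es', last es'}"
  shows "{hd vs, last vs} = {hd vs', last vs'}"
  using path_end_edges_unique[OF p ne] path_end_edges_unique[OF p(1) is_path_rev[OF p(2)]] ne eq
  by (auto simp: doubleton_eq_iff hd_rev last_rev)

text \<open>Take the path to \<open>r\<close> from an end \<open>p\<close> of \<open>e\<close>. If
  it misses the other end \<open>q\<close>, prefix \<open>q\<close> and \<open>e\<close>. If it
  visits \<open>q\<close>, it must use the bridge \<open>e\<close>, and only its first edge can
  touch its first vertex \<open>p\<close>.\<close>

lemma path_with_first_edge:
  assumes "e \<in> F" "ends H e \<subseteq> {x. conn H F r x}"
  obtains vs es where "is_path H F vs (e # es)" "last vs = r"
proof -
  obtain p q where e: "ends H e = {p, q}" "p \<in> verts H" "q \<in> verts H"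
    using edge_ends[OF finite_multigraph] assms edges by blast
  have "p \<noteq> q" using bridge[OF assms(1) e(1)] by auto
  have "conn H F p r" using assms e conn_sym by fastforce
  then obtain vs es where p: "is_path H F vs es" "hd vs = p" "last vs = r"
    using conn_path[OF finite_multigraph edges e(2)] by blast
  show ?thesis
  proof (cases "q \<in> set vs")
    case False
    then have "is_path H F (q # vs) (e # es)" using p e assms by (auto simp: is_path_Cons)
    then show ?thesis using that p is_path_nonempty[OF p(1)] by (metis last_ConsR)
  next
    case True
    have "e \<in> set es"
    proof (rule ccontr)
      assume "e \<notin> set es"
      then have "set es \<subseteq> F - {e}" using p by (auto simp: is_path_def)
      then show False using is_path_conn[OF p(1) True] bridge[OF assms(1) e(1)] p(2) conn_mono by metis
    qed
    then obtain f fs where es: "es = f # fs" by (cases es) auto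
    have "e \<notin> set fs"
      using is_path_ConsD(2,3)[of H F vs f fs] is_path_ends_subset[of H F "tl vs" fs e] p e es by auto
    then have "f = e" using \<open>e \<in> set es\<close> es by auto
    then show ?thesis using that p es by auto
  qed
qed

end


section \<open>Components of a forest\<close>

text \<open>Counts through a correspondence given as a relation. Vertices are matched with edges or
  weightings by the existence of a path, so no path has to be chosen by a function.\<close>

lemma card_eq_relation:
  assumes "\<And>x. x \<in> X \<Longrightarrow> \<exists>y\<in>Y. R x y" "\<And>y. y \<in> Y \<Longrightarrow> \<exists>x\<in>X. R x y"
    and "\<And>x y y'. R x y \<Longrightarrow> R x y' \<Longrightarrow> x \<in> X \<Longrightarrow> y \<in> Y \<Longrightarrow> y' \<in> Y \<Longrightarrow> y = y'"
    and "\<And>x x' y. R x y \<Longrightarrow> R x' y \<Longrightarrow> x \<in> X \<Longrightarrow> x' \<in> X \<Longrightarrow> y \<in> Y \<Longrightarrow> x = x'"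
  shows "card X = card Y"
proof -
  obtain f where f: "\<And>x. x \<in> X \<Longrightarrow> f x \<in> Y \<and> R x (f x)"
    using assms(1) by metis
  have "inj_on f X" by (metis f assms(4) inj_onI)
  moreover have "f ` X = Y" 
  proof
    show "Y \<subseteq> f ` X"
    proof
      fix y assume y: "y \<in> Y"
      then obtain x where x: "x \<in> X" "R x y" using assms(2) by blast
      then have "f x = y" using f[OF x(1)] assms(3) y by blast
      then show "y \<in> f ` X" using x(1) by blast
    qed
  qed (use f in blast)
  ultimately show ?thesis by (metis card_image)
qed

lemma in_components_iff: "S \<in> components H F \<longleftrightarrow> (\<exists>v\<in>verts H. S = {x. conn H F v x})"
  by (auto simp: components_def quotient_def)

lemma component_of_vertex: "v \<in> verts H \<Longrightarrow> {x. conn H F v x} \<in> components H F"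
  by (auto simp: in_components_iff)

lemma component_eq:
  assumes "S \<in> components H F" "x \<in> S"
  shows "S = {y. conn H F x y}"
  using assms by (auto simp: in_components_iff dest: conn_sym intro: rtrancl_trans)

lemma components_disjoint:
  "S \<in> components H F \<Longrightarrow> S' \<in> components H F \<Longrightarrow> x \<in> S \<Longrightarrow> x \<in> S' \<Longrightarrow> S = S'"
  by (metis component_eq)

lemma Union_components:
  assumes "finite_multigraph H" "F \<subseteq> edges H"
  shows "\<Union>(components H F) = verts H"
proof
  show "\<Union>(components H F) \<subseteq> verts H"
    using conn_verts[OF assms] by (auto simp: in_components_iff)
  show "verts H \<subseteq> \<Union>(components H F)"
  proof
    fix v assume "v \<in> verts H"
    then show "v \<in> \<Union>(components H F)" by (intro UnionI[OF component_of_vertex]) auto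
  qed
qed

lemma finite_components: "finite (verts H) \<Longrightarrow> finite (components H F)"
  by (simp add: components_def quotient_def)

lemma Union_component_edges:
  assumes "finite_multigraph H" "F \<subseteq> edges H"
  shows "(\<Union>S\<in>components H F. component_edges H F S) = F"
proof
  show "F \<subseteq> (\<Union>S\<in>components H F. component_edges H F S)"
  proof
    fix e assume e: "e \<in> F"
    then obtain u v where uv: "ends H e = {u, v}" "u \<in> verts H"
      using edge_ends[OF assms(1)] assms(2) by (metis subsetD)
    then have "e \<in> component_edges H F {x. conn H F u x}"
      using e conn_edge by (auto simp: component_edges_def)
    then show "e \<in> (\<Union>S\<in>components H F. component_edges H F S)"
      using component_of_vertex[OF uv(2)] by blast
  qed
qed (auto simp: component_edges_def)

lemma component_edges_disjoint:
  assumes "finite_multigraph H" "F \<subseteq> edges H"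
    and "S \<in> components H F" "S' \<in> components H F" "S \<noteq> S'"
  shows "component_edges H F S \<inter> component_edges H F S' = {}"
proof -
  have "S \<inter> S' = {}" using assms components_disjoint by fast
  moreover have "ends H e \<noteq> {}" if "e \<in> F" for e
    using edge_ends[OF assms(1)] that assms(2) by (metis insert_not_empty subsetD)
  ultimately have "\<not> (ends H e \<subseteq> S \<and> ends H e \<subseteq> S')" if "e \<in> F" for e
    using that by (metis Int_greatest subset_empty)
  then show ?thesis by (auto simp: component_edges_def)
qed

lemma path_in_component:
  assumes "is_path H F vs es" "S \<in> components H F" "x \<in> set vs" "x \<in> S"
  shows "set vs \<subseteq> S" "set es \<subseteq> component_edges H F S"
proof -
  show "set vs \<subseteq> S" using is_path_conn'[OF assms(1,3)] component_eq[OF assms(2,4)] by auto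
  then show "set es \<subseteq> component_edges H F S"
    using is_path_ends_subset[OF assms(1)] assms(1) by (force simp: component_edges_def is_path_def)
qed

lemma path_meets_component_edge:
  assumes "is_path H F vs es" "S \<in> components H F" "e \<in> set es" "e \<in> component_edges H F S"
  shows "set vs \<subseteq> S"
proof -
  obtain i where i: "i < length es" "e = es ! i" using assms(3) by (auto simp: in_set_conv_nth)
  then have "vs ! i \<in> set vs" "vs ! i \<in> ends H e"
    using assms(1) by (auto simp: is_path_def)
  then show ?thesis using path_in_component(1)[OF assms(1,2)] assms(4) by (auto simp: component_edges_def)
qed

context forest
begin

lemma finite_F: "finite F"
  using finite_multigraph edges by (auto simp: finite_multigraph_def intro: finite_subset)

lemma finite_verts: "finite (verts H)"
  using finite_multigraph by (simp add: finite_multigraph_def)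

lemma finite_component: "S \<in> components H F \<Longrightarrow> finite S"
  using Union_components[OF finite_multigraph edges] finite_verts by (metis Union_upper finite_subset)

lemma component_path:
  assumes "S \<in> components H F" "u \<in> S" "v \<in> S"
  obtains vs es where "is_path H F vs es" "hd vs = u" "last vs = v"
proof -
  have "u \<in> verts H" using assms Union_components[OF finite_multigraph edges] by auto
  moreover have "conn H F u v" using assms component_eq by fast
  ultimately show ?thesis using conn_path[OF finite_multigraph edges] that by metis
qed

lemma is_path_single_iff: "is_path H F vs es \<Longrightarrow> hd vs = last vs \<longleftrightarrow> es = []"
proof -
  assume p: "is_path H F vs es"
  show ?thesis
  proof (cases es)
    case Nil
    then show ?thesis using p by (auto simp: is_path_Nil)
  next
    case (Cons e es')
    then obtain u us where "vs = u # us" "u \<notin> set us" "is_path H F us es'"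
      using p by (auto elim: is_path_ConsE)
    moreover have "last us \<in> set us" "us \<noteq> []"
      using calculation is_path_hd_last_in(2) is_path_nonempty by metis+
    ultimately show ?thesis using Cons by auto
  qed
qed

lemma last_in_tl: "is_path H F vs (e # es) \<Longrightarrow> last vs \<in> set (tl vs)"
  by (erule is_path_ConsE) (metis is_path_nonempty last_ConsR last_in_set list.sel(3))

text \<open>Rooting the tree at r, each vertex other than r corresponds to the first edge on its way
  to r.\<close>

lemma card_component_edges:
  assumes S: "S \<in> components H F"
  shows "Suc (card (component_edges H F S)) = card S"
proof -
  obtain r where r: "r \<in> S" using S by (auto simp: in_components_iff)
  have "card (S - {r}) = card (component_edges H F S)"
  proof (rule card_eq_relation[where
      R = "\<lambda>v e. \<exists>vs es. is_path H F vs (e # es) \<and> hd vs = v \<and> last vs = r"])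
    fix v assume v: "v \<in> S - {r}"
    then obtain vs es where p: "is_path H F vs es" "hd vs = v" "last vs = r"
      using component_path[OF S] r by blast
    then obtain e es' where "es = e # es'" using is_path_single_iff v by (cases es) auto
    moreover have "set es \<subseteq> component_edges H F S"
      using path_in_component(2)[OF p(1) S] r p is_path_hd_last_in(2) by metis
    ultimately show "\<exists>e\<in>component_edges H F S. \<exists>vs es. is_path H F vs (e # es) \<and> hd vs = v \<and> last vs = r"
      using p by auto
  next
    fix e assume e: "e \<in> component_edges H F S"
    then obtain vs es where p: "is_path H F vs (e # es)" "last vs = r"
      using path_with_first_edge[of e r] component_eq[OF S r] by (auto simp: component_edges_def)
    have "hd vs \<noteq> r" using is_path_single_iff[OF p(1)] p(2) by auto
    moreover have "hd vs \<in> S"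
      using path_meets_component_edge[OF p(1) S] e is_path_hd_last_in(1)[OF p(1)] by auto
    ultimately show "\<exists>v\<in>S - {r}. \<exists>vs es. is_path H F vs (e # es) \<and> hd vs = v \<and> last vs = r"
      using p by auto
  next
    fix v e e'
    assume "\<exists>vs es. is_path H F vs (e # es) \<and> hd vs = v \<and> last vs = r"
      "\<exists>vs es. is_path H F vs (e' # es) \<and> hd vs = v \<and> last vs = r"
    then show "e = e'" using path_unique by (metis list.inject)
  next
    fix v v' e
    assume "\<exists>vs es. is_path H F vs (e # es) \<and> hd vs = v \<and> last vs = r"
      "\<exists>vs es. is_path H F vs (e # es) \<and> hd vs = v' \<and> last vs = r"
    then show "v = v'" using path_hd_unique last_in_tl by metis
  qed
  then show ?thesis using r finite_component[OF S] by (metis card_Suc_Diff1)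
qed

text \<open>Each component has one vertex more than it has edges; summing over the components gives
  the claim.\<close>

lemma card_forest: "card F + card (components H F) = card (verts H)"
proof -
  have fin: "finite (components H F)" using finite_components finite_verts .
  have finE: "finite (component_edges H F S)" for S
    using finite_F by (simp add: component_edges_def)
  have "card (verts H) = (\<Sum>S\<in>components H F. card S)"
    unfolding Union_components[OF finite_multigraph edges, symmetric]
  proof (rule card_Union_disjoint)
    show "pairwise disjnt (components H F)"
      using components_disjoint by (fastforce simp: pairwise_def disjnt_iff)
  qed (rule finite_component)
  also have "\<dots> = (\<Sum>S\<in>components H F. card (component_edges H F S) + 1)"
    using card_component_edges by (intro sum.cong) auto
  also have "\<dots> = card (\<Union>S\<in>components H F. component_edges H F S) + card (components H F)"
    using component_edges_disjoint[OF finite_multigraph edges] fin finE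
    by (subst card_UN_disjoint) (auto simp: sum_Suc)
  finally show ?thesis using Union_component_edges[OF finite_multigraph edges] by simp
qed

end

section \<open>Shortest paths and weightings as lists of extra units\<close>

lemma shortest_path_containing_exists:
  assumes "is_path H F vs es" "W \<subseteq> set es" "X \<subseteq> set vs"
  obtains vs' es' where "shortest_path_containing H F W X vs' es'"
proof -
  let ?P = "\<lambda>(vs, es). is_path H F vs es \<and> W \<subseteq> set es \<and> X \<subseteq> set vs"
  have "?P (vs, es)" using assms by simp
  then obtain p where "?P p" "\<forall>q. ?P q \<longrightarrow> length (snd p) \<le> length (snd q)"
    using ex_has_least_nat[of ?P "(vs, es)" "\<lambda>p. length (snd p)"] by auto
  then show ?thesis using that[of "fst p" "snd p"] by (auto simp: shortest_path_containing_def)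
qed

lemma shortest_path_containing_rev:
  "shortest_path_containing H F W X vs es \<Longrightarrow> shortest_path_containing H F W X (rev vs) (rev es)"
  by (auto simp: shortest_path_containing_def is_path_rev)

text \<open>Otherwise the first vertex and the first edge could be dropped, and a shorter path would
  still contain \<open>W\<close> and \<open>X\<close>.\<close>

lemma shortest_path_containing_hd:
  assumes p: "shortest_path_containing H F W X vs es" and "es \<noteq> []"
  shows "hd es \<in> W \<or> hd vs \<in> X"
proof (rule ccontr)
  assume n: "\<not> ?thesis"
  obtain e fs where es: "es = e # fs" using assms(2) by (cases es) auto
  have path: "is_path H F vs (e # fs)" "W \<subseteq> set es" "X \<subseteq> set vs"
    using p es by (auto simp: shortest_path_containing_def)
  have "set vs = insert (hd vs) (set (tl vs))"
    using is_path_nonempty[OF path(1)] by (cases vs) auto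
  then have "is_path H F (tl vs) fs" "W \<subseteq> set fs" "X \<subseteq> set (tl vs)"
    using is_path_ConsD(2)[OF path(1)] path n es by auto
  then have "length es \<le> length fs" using p by (auto simp: shortest_path_containing_def)
  then show False using es by simp
qed

lemma shortest_path_containing_last:
  assumes p: "shortest_path_containing H F W X vs es" and "es \<noteq> []"
  shows "last es \<in> W \<or> last vs \<in> X"
  using shortest_path_containing_hd[OF shortest_path_containing_rev[OF p]] assms(2)
  by (simp add: hd_rev)

text \<open>Starts with weight 1 everywhere and adds one unit for each occurrence in
  \<open>l\<close>, so that \<open>l\<close> lists the excess. The order of \<open>l\<close> is
  irrelevant; \<open>[e, e]\<close> gives weight 3 to \<open>e\<close>.\<close>

definition list_weight :: "'e set \<Rightarrow> 'e list \<Rightarrow> 'e \<Rightarrow> nat" where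
  "list_weight D l = (\<lambda>g\<in>D. Suc (count_list l g))"

lemma list_weight_props:
  assumes "finite D" "set l \<subseteq> D"
  shows "list_weight D l \<in> D \<rightarrow>\<^sub>E {1..}" "(\<Sum>e\<in>D. list_weight D l e - 1) = length l"
    "{e \<in> D. list_weight D l e \<ge> 2} = set l"
proof -
  show "(\<Sum>e\<in>D. list_weight D l e - 1) = length l"
    using sum_count_set[OF assms(2,1)] by (simp add: list_weight_def)
  have "count_list l e \<ge> 1 \<longleftrightarrow> e \<in> set l" for e
    by (metis count_list_0_iff less_one linorder_not_le)
  then show "{e \<in> D. list_weight D l e \<ge> 2} = set l"
    using assms by (auto simp: list_weight_def numeral_2_eq_2)
qed (auto simp: list_weight_def)

text \<open>Units of excess are taken away one at a time from edges of weight at least 2, until all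
  weights are 1.\<close>

lemma list_weight_exists:
  assumes "finite D" "w \<in> D \<rightarrow>\<^sub>E {1..}" "(\<Sum>e\<in>D. w e - 1) = n"
  obtains l where "set l \<subseteq> D" "length l = n" "w = list_weight D l"
proof -
  have "\<exists>l. set l \<subseteq> D \<and> length l = n \<and> w = list_weight D l"
    using assms(2,3)
  proof (induction n arbitrary: w)
    case 0
    then have "w e = 1" if "e \<in> D" for e using that assms(1) by (fastforce simp: PiE_iff)
    then have "w = list_weight D []"
      using 0 by (intro extensionalityI[of _ D]) (auto simp: list_weight_def PiE_iff)
    then show ?case by (intro exI[of _ "[]"]) simp
  next
    case (Suc n)
    have "(\<Sum>e\<in>D. w e - 1) \<noteq> 0" using Suc.prems(2) by simp
    then obtain e where e: "e \<in> D" "w e - 1 \<noteq> 0" by (rule sum.not_neutral_contains_not_neutral)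
    let ?w = "w(e := w e - 1)"
    have "?w \<in> D \<rightarrow>\<^sub>E {1..}" using Suc.prems(1) e by (auto simp: PiE_iff extensional_def)
    moreover have "(\<Sum>e\<in>D. ?w e - 1) = n"
      using Suc.prems(2) assms(1) e by (simp add: sum.remove[of D e])
    ultimately obtain l where l: "set l \<subseteq> D" "length l = n" "?w = list_weight D l"
      using Suc.IH by blast
    have "w = list_weight D (e # l)"
    proof
      fix g
      show "w g = list_weight D (e # l) g"
        using fun_cong[OF l(3), of g] e by (auto simp: list_weight_def split: if_splits)
    qed
    then show ?case using l e by (intro exI[of _ "e # l"]) auto
  qed
  then show ?thesis using that by blast
qed

lemma inj_list_weight_Cons: "inj_on (\<lambda>e. list_weight D [e]) D"
  by (rule inj_onI) (metis (no_types, lifting) count_list.simps list_weight_def n_not_Suc_n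
      restrict_apply' nat.inject add_0 Suc_eq_plus1 )

text \<open>Each crossing edge changes the side with respect to \<open>Z\<close> and every other
  edge keeps it, so the parity of the crossings only depends on the two ends of the path.\<close>

lemma odd_crossing_path:
  assumes "is_path H F vs es"
    and "\<And>e u v. e \<in> F \<Longrightarrow> ends H e = {u, v} \<Longrightarrow> cross e \<longleftrightarrow> (u \<in> Z) \<noteq> (v \<in> Z)"
  shows "odd (card {e \<in> set es. cross e}) \<longleftrightarrow> (hd vs \<in> Z) \<noteq> (last vs \<in> Z)"
  using assms(1)
proof (induction es arbitrary: vs)
  case (Cons e es)
  obtain u us where us: "vs = u # us" "e \<in> F" "ends H e = {u, hd us}" "is_path H F us es"
    using Cons.prems by (elim is_path_ConsE)
  have "e \<notin> set es" using is_path_distinct_edges[OF Cons.prems] by simp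
  have "{f \<in> set (e # es). cross f} = (if cross e then insert e else id) {f \<in> set es. cross f}"
    by auto
  then have "odd (card {f \<in> set (e # es). cross f}) \<longleftrightarrow> cross e \<noteq> odd (card {f \<in> set es. cross f})"
    using \<open>e \<notin> set es\<close> by auto
  then show ?case using Cons.IH[OF us(4)] assms(2)[OF us(2,3)] us is_path_nonempty[OF us(4)] by auto
qed (auto simp: is_path_Nil)


section \<open>Weightings of a tree\<close>

lemma bij_betw_split_set:
  assumes "\<And>i j. i \<in> I \<Longrightarrow> j \<in> I \<Longrightarrow> i \<noteq> j \<Longrightarrow> D i \<inter> D j = {}"
    and "\<And>i. i \<in> I \<Longrightarrow> L i \<subseteq> Pow (D i)"
  shows "bij_betw (\<lambda>S. \<lambda>i\<in>I. S \<inter> D i) {S. S \<subseteq> (\<Union>i\<in>I. D i) \<and> (\<forall>i\<in>I. S \<inter> D i \<in> L i)} (Pi\<^sub>E I L)"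
proof (rule bij_betwI[where g = "\<lambda>g. \<Union>i\<in>I. g i"])
  have *: "(\<Union>i\<in>I. g i) \<inter> D j = g j" if "g \<in> Pi\<^sub>E I L" "j \<in> I" for g j
  proof -
    have "g i \<subseteq> D i" if "i \<in> I" for i
      using that \<open>g \<in> Pi\<^sub>E I L\<close> assms(2) by (blast dest: PiE_mem)
    then show ?thesis using assms(1) that(2) by blast
  qed
  show "(\<lambda>g. \<Union>i\<in>I. g i) \<in> Pi\<^sub>E I L \<rightarrow> {S. S \<subseteq> (\<Union>i\<in>I. D i) \<and> (\<forall>i\<in>I. S \<inter> D i \<in> L i)}"
  proof (rule Pi_I)
    fix g assume g: "g \<in> Pi\<^sub>E I L"
    then have "g i \<in> L i" "g i \<subseteq> D i" if "i \<in> I" for i using assms(2) that by (auto dest: PiE_mem)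
    then show "(\<Union>i\<in>I. g i) \<in> {S. S \<subseteq> (\<Union>i\<in>I. D i) \<and> (\<forall>i\<in>I. S \<inter> D i \<in> L i)}"
      using *[OF g] by auto
  qed
  show "(\<lambda>i\<in>I. (\<Union>i\<in>I. g i) \<inter> D i) = g" if "g \<in> Pi\<^sub>E I L" for g
    using *[OF that] that by (intro extensionalityI[of _ I]) (auto simp: PiE_iff)
qed auto

lemma bij_betw_split_function:
  assumes "\<And>i j. i \<in> I \<Longrightarrow> j \<in> I \<Longrightarrow> i \<noteq> j \<Longrightarrow> D i \<inter> D j = {}"
    and L: "\<And>i. i \<in> I \<Longrightarrow> L i \<subseteq> D i \<rightarrow>\<^sub>E R"
  shows "bij_betw (\<lambda>w. \<lambda>i\<in>I. restrict w (D i))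
    {w \<in> (\<Union>i\<in>I. D i) \<rightarrow>\<^sub>E R. \<forall>i\<in>I. restrict w (D i) \<in> L i} (Pi\<^sub>E I L)"
proof -
  \<comment> \<open>\<open>k e\<close> is the index of the block containing \<open>e\<close>. It is
    needed to glue the local functions together to a global one.\<close>
  obtain k where k: "\<And>e. e \<in> (\<Union>i\<in>I. D i) \<Longrightarrow> k e \<in> I \<and> e \<in> D (k e)"
    by (metis UN_E)
  have k': "k e = i" if "e \<in> D i" "i \<in> I" for e i
    using k[of e] that assms(1) by blast
  let ?g = "\<lambda>g. \<lambda>e\<in>(\<Union>i\<in>I. D i). g (k e) e"
  have *: "restrict (?g g) (D i) = g i" if g: "g \<in> Pi\<^sub>E I L" and i: "i \<in> I" for g i
  proof (rule extensionalityI[of _ "D i"])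
    show "g i \<in> extensional (D i)" using PiE_mem[OF g i] L[OF i] by (auto simp: PiE_iff)
  qed (use i k' in auto)
  show ?thesis
  proof (rule bij_betwI[where g = ?g])
    show "?g \<in> Pi\<^sub>E I L \<rightarrow> {w \<in> (\<Union>i\<in>I. D i) \<rightarrow>\<^sub>E R. \<forall>i\<in>I. restrict w (D i) \<in> L i}"
    proof (rule Pi_I)
      fix g assume g: "g \<in> Pi\<^sub>E I L"
      have "g (k e) e \<in> R" if "e \<in> (\<Union>i\<in>I. D i)" for e
        using PiE_mem[OF g, of "k e"] L[of "k e"] k[OF that] by (auto simp: PiE_iff)
      then have "?g g \<in> (\<Union>i\<in>I. D i) \<rightarrow>\<^sub>E R" by (intro restrict_PiE_iff[THEN iffD2]) blast
      moreover have "restrict (?g g) (D i) \<in> L i" if "i \<in> I" for i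
        using *[OF g that] PiE_mem[OF g that] by simp
      ultimately show "?g g \<in> {w \<in> (\<Union>i\<in>I. D i) \<rightarrow>\<^sub>E R. \<forall>i\<in>I. restrict w (D i) \<in> L i}" by blast
    qed
    show "(\<lambda>i\<in>I. restrict (?g g) (D i)) = g" if g: "g \<in> Pi\<^sub>E I L" for g
      using *[OF g] g by (intro extensionalityI[of _ I]) (auto simp: PiE_iff)
    show "?g (\<lambda>i\<in>I. restrict w (D i)) = w"
      if "w \<in> {w \<in> (\<Union>i\<in>I. D i) \<rightarrow>\<^sub>E R. \<forall>i\<in>I. restrict w (D i) \<in> L i}" for w
      using that k by (intro extensionalityI[of _ "\<Union>i\<in>I. D i"]) (auto simp: PiE_iff)
  qed auto
qed

text \<open>The families with at most one special entry split into those with none and, for each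
  index \<open>i\<close>, those special exactly at \<open>i\<close>. Each class is a product set, so
  its sum factors. This one formula serves both for extensions by edges of \<open>T\<close> and for
  weightings.\<close>

lemma sum_at_most_one_special:
  fixes f :: "'i \<Rightarrow> 'y \<Rightarrow> 'a :: comm_semiring_1"
  assumes I: "finite I" and fin: "\<And>i. i \<in> I \<Longrightarrow> finite (N i)" "\<And>i. i \<in> I \<Longrightarrow> finite (Q i)"
    and disj: "\<And>i. i \<in> I \<Longrightarrow> N i \<inter> Q i = {}"
    and bij: "bij_betw p X (Pi\<^sub>E I (\<lambda>i. N i \<union> Q i))"
  shows "(\<Sum>x\<in>{x \<in> X. card {i \<in> I. p x i \<in> Q i} \<le> 1}. \<Prod>i\<in>I. f i (p x i)) =
    (\<Prod>i\<in>I. sum (f i) (N i)) + (\<Sum>i\<in>I. sum (f i) (Q i) * (\<Prod>j\<in>I - {i}. sum (f j) (N j)))"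
proof -
  let ?Y = "{g \<in> Pi\<^sub>E I (\<lambda>i. N i \<union> Q i). card {i \<in> I. g i \<in> Q i} \<le> 1}"
  let ?B = "\<lambda>i. Pi\<^sub>E I (N(i := Q i))"
  have "bij_betw p {x \<in> X. card {i \<in> I. p x i \<in> Q i} \<le> 1} ?Y"
    using bij unfolding bij_betw_def by (auto intro: inj_on_subset)
  then have "(\<Sum>x\<in>{x \<in> X. card {i \<in> I. p x i \<in> Q i} \<le> 1}. \<Prod>i\<in>I. f i (p x i)) =
      (\<Sum>g\<in>?Y. \<Prod>i\<in>I. f i (g i))"
    by (rule sum.reindex_bij_betw)
  also have "?Y = Pi\<^sub>E I N \<union> (\<Union>i\<in>I. ?B i)"
  proof (intro equalityI subsetI)
    fix g assume g: "g \<in> ?Y"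
    show "g \<in> Pi\<^sub>E I N \<union> (\<Union>i\<in>I. ?B i)"
    proof (cases "{i \<in> I. g i \<in> Q i} = {}")
      case True
      then show ?thesis using g by (auto simp: PiE_iff)
    next
      case False
      then have "card {i \<in> I. g i \<in> Q i} \<noteq> 0" using I by simp
      moreover have "card {i \<in> I. g i \<in> Q i} \<le> 1" using g by blast
      ultimately have "card {i \<in> I. g i \<in> Q i} = 1" by linarith
      then obtain i where "{i \<in> I. g i \<in> Q i} = {i}" by (rule card_1_singletonE)
      then have "g \<in> ?B i" "i \<in> I" using g by (auto simp: PiE_iff)
      then show ?thesis by blast
    qed
  next
    fix g assume g: "g \<in> Pi\<^sub>E I N \<union> (\<Union>i\<in>I. ?B i)"
    then obtain i where i: "{j \<in> I. g j \<in> Q j} \<subseteq> {i}"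
      using disj by (fastforce simp: PiE_iff split: if_splits)
    have "card {j \<in> I. g j \<in> Q j} \<le> 1" using card_mono[OF _ i] by simp
    then show "g \<in> ?Y" using g by (auto simp: PiE_iff split: if_splits)
  qed
  also have "(\<Sum>g\<in>Pi\<^sub>E I N \<union> (\<Union>i\<in>I. ?B i). \<Prod>i\<in>I. f i (g i)) =
      (\<Sum>g\<in>Pi\<^sub>E I N. \<Prod>i\<in>I. f i (g i)) + (\<Sum>g\<in>(\<Union>i\<in>I. ?B i). \<Prod>i\<in>I. f i (g i))"
  proof (rule sum.union_disjoint)
    show "Pi\<^sub>E I N \<inter> (\<Union>i\<in>I. ?B i) = {}"
      using disj by (fastforce simp: PiE_iff split: if_splits)
  qed (use I fin in \<open>auto intro!: finite_PiE\<close>)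
  also have "(\<Sum>g\<in>(\<Union>i\<in>I. ?B i). \<Prod>i\<in>I. f i (g i)) = (\<Sum>i\<in>I. \<Sum>g\<in>?B i. \<Prod>i\<in>I. f i (g i))"
  proof (rule sum.UNION_disjoint)
    show "\<forall>i\<in>I. \<forall>j\<in>I. i \<noteq> j \<longrightarrow> ?B i \<inter> ?B j = {}"
      using disj by (fastforce simp: PiE_iff split: if_splits)
  qed (use I fin in \<open>auto intro!: finite_PiE\<close>)
  also have "(\<Sum>g\<in>Pi\<^sub>E I N. \<Prod>i\<in>I. f i (g i)) = (\<Prod>i\<in>I. sum (f i) (N i))"
    using I fin by (subst prod_sum_PiE) auto
  also have "(\<Sum>i\<in>I. \<Sum>g\<in>?B i. \<Prod>i\<in>I. f i (g i)) =
      (\<Sum>i\<in>I. sum (f i) (Q i) * (\<Prod>j\<in>I - {i}. sum (f j) (N j)))"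
  proof (rule sum.cong[OF refl])
    fix i assume i: "i \<in> I"
    have "(\<Sum>g\<in>?B i. \<Prod>i\<in>I. f i (g i)) = (\<Prod>j\<in>I. sum (f j) ((N(i := Q i)) j))"
      using I fin by (subst prod_sum_PiE) auto
    also have "\<dots> = sum (f i) (Q i) * (\<Prod>j\<in>I - {i}. sum (f j) ((N(i := Q i)) j))"
      using I i by (simp add: prod.remove[of I i])
    finally show "(\<Sum>g\<in>?B i. \<Prod>i\<in>I. f i (g i)) =
        sum (f i) (Q i) * (\<Prod>j\<in>I - {i}. sum (f j) (N j))" by simp
  qed
  finally show ?thesis .
qed

lemma bounded_excess_weights_eq:
  assumes "finite D"
  shows "{w \<in> D \<rightarrow>\<^sub>E {1::nat..}. (\<Sum>e\<in>D. w e - 1) \<le> n} = list_weight D ` {l. set l \<subseteq> D \<and> length l \<le> n}"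
proof (intro equalityI subsetI)
  fix w assume w: "w \<in> {w \<in> D \<rightarrow>\<^sub>E {1::nat..}. (\<Sum>e\<in>D. w e - 1) \<le> n}"
  then obtain l where "set l \<subseteq> D" "length l = (\<Sum>e\<in>D. w e - 1)" "w = list_weight D l"
    using list_weight_exists[OF assms _ refl] by blast
  then show "w \<in> list_weight D ` {l. set l \<subseteq> D \<and> length l \<le> n}" using w by auto
qed (use list_weight_props[OF assms] in auto)

lemma finite_bounded_excess_weights:
  "finite D \<Longrightarrow> finite {w \<in> D \<rightarrow>\<^sub>E {1::nat..}. (\<Sum>e\<in>D. w e - 1) \<le> n}"
  by (subst bounded_excess_weights_eq) (auto intro: finite_lists_length_le)

text \<open>The weightings of excess at most 1 are \<open>list_weight D []\<close> and one
  \<open>list_weight D [e]\<close> for each edge.\<close>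

lemma sum_normal_weights:
  fixes x :: "'a :: comm_semiring_1"
  assumes "finite D"
  shows "(\<Sum>w\<in>{w \<in> D \<rightarrow>\<^sub>E {1::nat..}. (\<Sum>e\<in>D. w e - 1) \<le> 1}. x ^ (\<Sum>e\<in>D. w e - 1)) = 1 + of_nat (card D) * x"
proof -
  have "{l. set l \<subseteq> D \<and> length l \<le> 1} = insert [] ((\<lambda>e. [e]) ` D)"
    by (auto simp: le_Suc_eq length_Suc_conv)
  then have eq: "{w \<in> D \<rightarrow>\<^sub>E {1::nat..}. (\<Sum>e\<in>D. w e - 1) \<le> 1} =
      insert (list_weight D []) ((\<lambda>e. list_weight D [e]) ` D)"
    by (subst bounded_excess_weights_eq[OF assms]) auto
  have "list_weight D [] \<noteq> list_weight D [e]" if "e \<in> D" for e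
    using list_weight_props(2)[OF assms, of "[]"] list_weight_props(2)[OF assms, of "[e]"] that
    by auto
  then show ?thesis
    unfolding eq using assms list_weight_props(2)[OF assms]
    by (subst sum.insert) (auto simp: sum.reindex inj_list_weight_Cons)
qed

text \<open>Common form of both parity conditions: \<open>X\<close> is empty for an ordinary
  component and consists of \<open>ZeroBar\<close> for the component of that vertex.\<close>

definition odd_shortest_path ::
  "('v, 'e) multigraph \<Rightarrow> 'e set \<Rightarrow> ('e \<Rightarrow> bool) \<Rightarrow> 'e set \<Rightarrow> 'v set \<Rightarrow> bool" where
  "odd_shortest_path H F cross W X \<longleftrightarrow>
     (\<exists>vs es. shortest_path_containing H F W X vs es \<and> odd (card {e \<in> set es. cross e}))"

context forest
begin

text \<open>By minimality both end edges belong to \<open>W\<close>. If they coincide, the path has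
  just one edge, and then \<open>W\<close> is that single edge.\<close>

lemma shortest_path_end_edges:
  assumes "shortest_path_containing H F W {} vs es" "W = {e, f}"
  shows "es \<noteq> []" "{hd es, last es} = {e, f}"
proof -
  have p: "is_path H F vs es" "W \<subseteq> set es" using assms by (auto simp: shortest_path_containing_def)
  show ne: "es \<noteq> []" using p assms by auto
  have hl: "hd es \<in> {e, f}" "last es \<in> {e, f}"
    using shortest_path_containing_hd[OF assms(1) ne] shortest_path_containing_last[OF assms(1) ne] assms(2)
    by auto
  have "es = [hd es]" if "hd es = last es"
  proof -
    obtain g gs where es: "es = g # gs" using ne by (cases es) auto
    then have "gs = []"
      using is_path_distinct_edges[OF p(1)] that last_in_set[of gs] by (auto split: if_splits)
    then show ?thesis using es by simp
  qed
  then show "{hd es, last es} = {e, f}"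
  proof (cases "hd es = last es")
    case True
    then have "set es = {hd es}"
      using \<open>hd es = last es \<Longrightarrow> es = [hd es]\<close> by (metis empty_set list.simps(15))
    then show ?thesis using True hl p(2) assms(2) by auto
  qed (use hl in auto)
qed

text \<open>A pair of vertices on different sides of \<open>Z\<close> is sent to the weighting with
  one extra unit on each end edge of the path joining them (two units if the path is a single edge).
  Conversely the shortest path through the weighted edges recovers the pair. Writing the vertex in
  \<open>Z\<close> first fixes the order.\<close>

lemma card_special_weights:
  assumes S: "S \<in> components H F"
    and cross: "\<And>e u v. e \<in> F \<Longrightarrow> ends H e = {u, v} \<Longrightarrow> cross e \<longleftrightarrow> (u \<in> Z) \<noteq> (v \<in> Z)"
  defines "D \<equiv> component_edges H F S"
  shows "card {w \<in> D \<rightarrow>\<^sub>E {1::nat..}. (\<Sum>e\<in>D. w e - 1) = 2 \<and>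
      odd_shortest_path H F cross {e \<in> D. w e \<ge> 2} {}} = card (S \<inter> Z) * card (S - Z)"
proof -
  let ?Q = "{w \<in> D \<rightarrow>\<^sub>E {1::nat..}. (\<Sum>e\<in>D. w e - 1) = 2 \<and>
      odd_shortest_path H F cross {e \<in> D. w e \<ge> 2} {}}"
  let ?R = "\<lambda>(u, v) w. \<exists>vs es. is_path H F vs es \<and> hd vs = u \<and> last vs = v \<and> es \<noteq> [] \<and>
    w = list_weight D [hd es, last es]"
  have parity: "odd (card {e \<in> set es. cross e}) \<longleftrightarrow> (hd vs \<in> Z) \<noteq> (last vs \<in> Z)"
    if "is_path H F vs es" for vs es
    using odd_crossing_path[where cross = cross and Z = Z, OF that] cross by blast
  have finD: "finite D" using finite_F by (simp add: D_def component_edges_def)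
  have inD: "set [hd es, last es] \<subseteq> D"
    if "is_path H F vs es" "es \<noteq> []" "x \<in> set vs" "x \<in> S" for vs es x
    using path_in_component(2)[OF that(1) S that(3,4)] that(2) by (auto simp: D_def)
  have "card ((S \<inter> Z) \<times> (S - Z)) = card ?Q"
  proof (rule card_eq_relation[where R = ?R])
    fix p assume "p \<in> (S \<inter> Z) \<times> (S - Z)"
    then obtain u v where uv: "p = (u, v)" "u \<in> S" "u \<in> Z" "v \<in> S" "v \<notin> Z" by auto
    obtain vs es where p: "is_path H F vs es" "hd vs = u" "last vs = v"
      using component_path[OF S uv(2,4)] .
    have ne: "es \<noteq> []" using is_path_single_iff[OF p(1)] p uv by auto
    let ?l = "[hd es, last es]"
    have l: "set ?l \<subseteq> D" using inD[OF p(1) ne, of u] is_path_hd_last_in(1)[OF p(1)] p uv by auto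
    \<comment> \<open>The parity condition speaks of a shortest path through the two edges. Having
      the same end edges as the given path, it joins the same two vertices.\<close>
    obtain vs' es' where s: "shortest_path_containing H F (set ?l) {} vs' es'"
      by (rule shortest_path_containing_exists[OF p(1), of "set ?l" "{}"]) (use ne in auto)
    have p': "is_path H F vs' es'" using s by (simp add: shortest_path_containing_def)
    have "es' \<noteq> []" "{hd es', last es'} = {hd es, last es}"
      using shortest_path_end_edges[OF s] by simp_all
    then have "{hd vs', last vs'} = {u, v}"
      using path_end_edges_unique'[OF p' p(1)] ne p by simp
    then have "(hd vs' \<in> Z) \<noteq> (last vs' \<in> Z)" using uv by (auto simp: doubleton_eq_iff)
    then have "odd_shortest_path H F cross (set ?l) {}"
      using parity[OF p'] s unfolding odd_shortest_path_def by blast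
    then have "list_weight D ?l \<in> ?Q"
      using list_weight_props[OF finD l] by simp
    then show "\<exists>w\<in>?Q. ?R p w" using p ne uv(1) by auto
  next
    fix w assume w: "w \<in> ?Q"
    then obtain l where l: "set l \<subseteq> D" "length l = 2" "w = list_weight D l"
      using list_weight_exists[OF finD, of w 2] by blast
    then obtain e f where ef: "l = [e, f]" by (auto simp: length_Suc_conv numeral_2_eq_2)
    then have "{g \<in> D. w g \<ge> 2} = {e, f}" using list_weight_props(3)[OF finD l(1)] l by simp
    then obtain vs es where s: "shortest_path_containing H F {e, f} {} vs es"
      "odd (card {e \<in> set es. cross e})"
      using w by (auto simp: odd_shortest_path_def)
    have p: "is_path H F vs es" "{e, f} \<subseteq> set es" using s by (auto simp: shortest_path_containing_def)
    have es: "es \<noteq> []" "{hd es, last es} = {e, f}" using shortest_path_end_edges[OF s(1)] by auto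
    \<comment> \<open>Both orders are recorded, because the path may have to be reversed to start in
      \<open>Z\<close>.\<close>
    then have w': "w = list_weight D [hd es, last es]" "w = list_weight D [last es, hd es]"
      using l ef by (auto simp: doubleton_eq_iff list_weight_def)
    have sub: "set vs \<subseteq> S"
      using path_meets_component_edge[OF p(1) S, of e] p(2) l(1) ef by (auto simp: D_def)
    have in_S: "hd vs \<in> S" "last vs \<in> S" using is_path_hd_last_in[OF p(1)] sub by auto
    have Z: "(hd vs \<in> Z) \<noteq> (last vs \<in> Z)" using parity[OF p(1)] s(2) by blast
    have R1: "?R (hd vs, last vs) w" using p(1) es(1) w' by auto
    have R2: "?R (last vs, hd vs) w"
      using is_path_rev[OF p(1)] es(1) w' is_path_nonempty[OF p(1)]
      by (auto intro!: exI[of _ "rev vs"] exI[of _ "rev es"] simp: hd_rev last_rev)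
    show "\<exists>p\<in>(S \<inter> Z) \<times> (S - Z). ?R p w"
    proof (cases "hd vs \<in> Z")
      case True
      then show ?thesis using Z in_S by (intro bexI[where x = "(hd vs, last vs)"], intro R1) auto
    next
      case False
      then show ?thesis using Z in_S by (intro bexI[where x = "(last vs, hd vs)"], intro R2) auto
    qed
  next
    fix p w w' assume R: "?R p w" "?R p w'"
    obtain vs es where p: "is_path H F vs es" "p = (hd vs, last vs)"
      "w = list_weight D [hd es, last es]" using R(1) by (cases p) auto
    obtain vs' es' where p': "is_path H F vs' es'" "p = (hd vs', last vs')"
      "w' = list_weight D [hd es', last es']" using R(2) by (cases p) auto
    show "w = w'" using path_unique[OF p(1) p'(1)] p p' by simp
  next
    fix p p' w
    assume R: "?R p w" "?R p' w" and X: "p \<in> (S \<inter> Z) \<times> (S - Z)" "p' \<in> (S \<inter> Z) \<times> (S - Z)"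
    obtain vs es where p: "is_path H F vs es" "p = (hd vs, last vs)" "es \<noteq> []"
      "w = list_weight D [hd es, last es]" using R(1) by (cases p) auto
    obtain vs' es' where p': "is_path H F vs' es'" "p' = (hd vs', last vs')" "es' \<noteq> []"
      "w = list_weight D [hd es', last es']" using R(2) by (cases p') auto
    have "set [hd es, last es] \<subseteq> D" "set [hd es', last es'] \<subseteq> D"
      using inD[OF p(1,3) is_path_hd_last_in(1)[OF p(1)]] inD[OF p'(1,3) is_path_hd_last_in(1)[OF p'(1)]]
        X p(2) p'(2) by auto
    then have "set [hd es, last es] = set [hd es', last es']"
      using list_weight_props(3)[OF finD] p(4) p'(4) by metis
    then have "{hd vs, last vs} = {hd vs', last vs'}"
      using path_end_edges_unique'[OF p(1) p'(1)] p(3) p'(3) by simp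
    then show "p = p'" using X p(2) p'(2) by (auto simp: doubleton_eq_iff)
  qed
  then show ?thesis by (simp add: card_cartesian_product)
qed

text \<open>By minimality each end of the path is marked by \<open>e\<close> or by \<open>r\<close>.
  Up to reversal the path therefore starts with \<open>e\<close> and ends at \<open>r\<close>; the
  unordered pair of its ends, which decides the parity, is kept.\<close>

lemma shortest_path_end_rooted:
  assumes s: "shortest_path_containing H F {e} {r} vs es"
  obtains vs' es' where "shortest_path_containing H F {e} {r} vs' (e # es')" "last vs' = r"
    "{hd vs', last vs'} = {hd vs, last vs}"
proof -
  have p: "is_path H F vs es" "e \<in> set es" "r \<in> set vs"
    using s by (auto simp: shortest_path_containing_def)
  have ne: "es \<noteq> []" using p by auto
  have rev: "shortest_path_containing H F {e} {r} (rev vs) (rev es)"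
    "last (rev vs) = hd vs" "hd (rev vs) = last vs" "hd (rev es) = last es"
    using shortest_path_containing_rev[OF s] p ne is_path_nonempty[OF p(1)] by (auto simp: hd_rev last_rev)
  have c: "hd es = e \<or> hd vs = r" "last es = e \<or> last vs = r"
    using shortest_path_containing_hd[OF s ne] shortest_path_containing_last[OF s ne] by auto
  have "hd vs \<noteq> last vs" using is_path_single_iff[OF p(1)] ne by simp
  \<comment> \<open>If \<open>e\<close> is both the first and the last edge, the path is just
    \<open>e\<close>, and \<open>r\<close> on it must be one of its ends.\<close>
  moreover have "hd vs = r \<or> last vs = r" if hl: "hd es = e" "last es = e"
  proof -
    obtain gs where es: "es = e # gs" using ne hl by (cases es) auto
    then have "gs = []"
      using is_path_distinct_edges[OF p(1)] hl last_in_set[of gs] by (auto split: if_splits)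
    then obtain u where "tl vs = [u]" using is_path_ConsD(2)[of H F vs e gs] p es by (auto simp: is_path_Nil)
    then have "vs = [hd vs, u]" using is_path_nonempty[OF p(1)] by (metis list.collapse)
    then have "r = hd vs \<or> r = u" "last vs = u" using p(3) by (metis empty_iff insert_iff list.set, metis last.simps list.distinct(1))
    then show ?thesis by auto
  qed
  ultimately consider "hd es = e" "last vs = r" | "last es = e" "hd vs = r" using c by auto
  then show ?thesis
  proof cases
    case 1
    then show ?thesis using that[of vs "tl es"] s ne by auto
  next
    case 2
    then have "rev es = e # tl (rev es)" using rev(4) ne by (metis list.collapse rev_is_Nil_conv)
    then show ?thesis using that[of "rev vs" "tl (rev es)"] rev 2 by (metis insert_commute)
  qed
qed

text \<open>The vertex \<open>v\<close> is matched with the first edge on its way to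
  \<open>r\<close>, which receives the only extra unit. As \<open>r\<close> lies outside
  \<open>Z\<close>, odd parity means that \<open>v\<close> lies in \<open>Z\<close>; in particular
  \<open>v\<close> is not \<open>r\<close>.\<close>

lemma card_special_weights_rooted:
  assumes S: "S \<in> components H F" and r: "r \<in> S" "r \<notin> Z"
    and cross: "\<And>e u v. e \<in> F \<Longrightarrow> ends H e = {u, v} \<Longrightarrow> cross e \<longleftrightarrow> (u \<in> Z) \<noteq> (v \<in> Z)"
  defines "D \<equiv> component_edges H F S"
  shows "card {w \<in> D \<rightarrow>\<^sub>E {1::nat..}. (\<Sum>e\<in>D. w e - 1) = 1 \<and>
      odd_shortest_path H F cross {e \<in> D. w e \<ge> 2} {r}} = card (S \<inter> Z)"
proof -
  let ?Q = "{w \<in> D \<rightarrow>\<^sub>E {1::nat..}. (\<Sum>e\<in>D. w e - 1) = 1 \<and>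
      odd_shortest_path H F cross {e \<in> D. w e \<ge> 2} {r}}"
  let ?R = "\<lambda>v w. \<exists>vs e es. is_path H F vs (e # es) \<and> hd vs = v \<and> last vs = r \<and>
    w = list_weight D [e]"
  have parity: "odd (card {e \<in> set es. cross e}) \<longleftrightarrow> (hd vs \<in> Z) \<noteq> (last vs \<in> Z)"
    if "is_path H F vs es" for vs es
    using odd_crossing_path[where cross = cross and Z = Z, OF that] cross by blast
  have finD: "finite D" using finite_F by (simp add: D_def component_edges_def)
  have inD: "e \<in> D" if "is_path H F vs (e # es)" "last vs = r" for vs e es
    using path_in_component(2)[OF that(1) S] is_path_hd_last_in(2)[OF that(1)] that(2) r by (auto simp: D_def)
  have "card (S \<inter> Z) = card ?Q"
  proof (rule card_eq_relation[where R = ?R])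
    fix v assume v: "v \<in> S \<inter> Z"
    obtain vs fs where p0: "is_path H F vs fs" "hd vs = v" "last vs = r"
      using component_path[OF S, of v r] v r by blast
    then obtain e es where p: "is_path H F vs (e # es)"
      using is_path_single_iff[OF p0(1)] v r by (cases fs) auto
    have e: "set [e] \<subseteq> D" using inD[OF p p0(3)] by simp
    obtain us gs where "shortest_path_containing H F {e} {r} us gs"
      by (rule shortest_path_containing_exists[OF p, of "{e}" "{r}"])
        (use p0 is_path_hd_last_in(2)[OF p] in auto)
    then obtain vs' es' where s: "shortest_path_containing H F {e} {r} vs' (e # es')" "last vs' = r"
      by (rule shortest_path_end_rooted)
    have p': "is_path H F vs' (e # es')" using s by (simp add: shortest_path_containing_def)
    have "hd vs' = v"
      using path_hd_unique[OF p p', of r] last_in_tl[OF p] last_in_tl[OF p'] p0 s by simp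
    then have "odd (card {g \<in> set (e # es'). cross g})"
      using parity[OF p'] s(2) v r by blast
    then have "odd_shortest_path H F cross {e} {r}"
      using s unfolding odd_shortest_path_def by blast
    then have "list_weight D [e] \<in> ?Q"
      using list_weight_props[OF finD e] by simp
    then show "\<exists>w\<in>?Q. ?R v w" using p p0 by auto
  next
    fix w assume w: "w \<in> ?Q"
    then obtain l where l: "set l \<subseteq> D" "length l = 1" "w = list_weight D l"
      using list_weight_exists[OF finD, of w 1] by blast
    then obtain e where e: "l = [e]" by (auto simp: length_Suc_conv)
    then have "{g \<in> D. w g \<ge> 2} = {e}" using list_weight_props(3)[OF finD l(1)] l by simp
    then obtain us gs where s0: "shortest_path_containing H F {e} {r} us gs"
      "odd (card {e \<in> set gs. cross e})"
      using w by (auto simp: odd_shortest_path_def)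
    have p0: "is_path H F us gs" using s0 by (simp add: shortest_path_containing_def)
    obtain vs es where s: "shortest_path_containing H F {e} {r} vs (e # es)" "last vs = r"
      "{hd vs, last vs} = {hd us, last us}"
      using shortest_path_end_rooted[OF s0(1)] by metis
    have p: "is_path H F vs (e # es)" using s by (simp add: shortest_path_containing_def)
    have "(hd us \<in> Z) \<noteq> (last us \<in> Z)" using parity[OF p0] s0(2) by blast
    then have "hd vs \<in> Z" using s r by (auto simp: doubleton_eq_iff)
    moreover have "hd vs \<in> S"
      using path_in_component(1)[OF p S, of r] is_path_hd_last_in[OF p] s r by auto
    ultimately show "\<exists>v\<in>S \<inter> Z. ?R v w" using p s l e by blast
  next
    fix v w w' assume "?R v w" "?R v w'"
    then show "w = w'" using path_unique by (metis list.inject)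
  next
    fix v v' w assume R: "?R v w" "?R v' w"
    obtain vs e es where p: "is_path H F vs (e # es)" "hd vs = v" "last vs = r" "w = list_weight D [e]"
      using R(1) by auto
    obtain vs' e' es' where p': "is_path H F vs' (e' # es')" "hd vs' = v'" "last vs' = r"
      "w = list_weight D [e']"
      using R(2) by auto
    have "e = e'"
      using inj_onD[OF inj_list_weight_Cons] inD[OF p(1,3)] inD[OF p'(1,3)] p(4) p'(4) by metis
    then show "v = v'"
      using path_hd_unique[OF p(1), of vs' es' r] last_in_tl[OF p(1)] last_in_tl[OF p'(1)] p p' by simp
  qed
  then show ?thesis by simp
qed

end


section \<open>Forests of the biconing\<close>

text \<open>This form of acyclicity only refers to the ends of edges, which allows the transfer
  between the biconing and the reduced graph.\<close>

lemma acyclic_edges_iff_bridges: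
  assumes "finite_multigraph H" "F \<subseteq> edges H"
  shows "acyclic_edges H F \<longleftrightarrow> (\<forall>e\<in>F. \<forall>u v. ends H e = {u, v} \<longrightarrow> \<not> conn H (F - {e}) u v)"
proof -
  have "acyclic_edges H {}" by (auto simp: acyclic_edges_def is_cycle_def)
  then show ?thesis using acyclic_edges_Un_iff[OF assms(1) _ assms(2), of "{}"] by simp
qed

lemma adjacency_empty: "adjacency H {} = {}"
  by (simp add: adjacency_def)

lemma adjacency_cong_ends: "ends H = ends H' \<Longrightarrow> adjacency H F = adjacency H' F"
  by (simp add: adjacency_def)

section \<open>The biconing, the reduced graph and the tree\<close>

locale biconed =
  fixes G :: "('v, 'e) multigraph" and A B :: "'v set"
  assumes finite_G: "finite_multigraph G"
    and A: "A \<subseteq> verts G" and B: "B \<subseteq> verts G" and AB: "A \<union> B = verts G"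
begin

definition "H = biconing G A B"
definition "R = reduced_biconing G A B"
definition T :: "('v, 'e) bicone_edge set" where "T = tree0 A B"
definition ZA :: "'v bicone_vertex set" where "ZA = Vertex ` A"

lemma ends_H [simp]: "ends H = bicone_ends G"
  by (simp add: H_def biconing_def)

lemma ends_R [simp]: "ends R = bicone_ends G"
  by (simp add: R_def reduced_biconing_def delete_vertex_def delete_edges_def biconing_def)

lemma verts_H: "verts H = {Zero, ZeroBar} \<union> Vertex ` verts G"
  by (simp add: H_def biconing_def)

lemma verts_R: "verts R = insert ZeroBar (Vertex ` verts G)"
  by (auto simp: R_def reduced_biconing_def delete_vertex_def delete_edges_def biconing_def)

lemma ZeroBar_R: "ZeroBar \<in> verts R" and Zero_R: "Zero \<notin> verts R"
  by (auto simp: verts_R)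

lemma T_eq: "T = {ConeEdge} \<union> EdgeA ` A \<union> EdgeB ` (B - A)"
  by (simp add: T_def tree0_def)

lemma edges_R: "edges R = EdgeB ` (A \<inter> B) \<union> Edge ` edges G"
  by (auto simp: R_def reduced_biconing_def delete_vertex_def delete_edges_def biconing_def tree0_def)

lemma edges_H: "edges H = edges R \<union> T"
  unfolding edges_R T_eq using AB by (auto simp: H_def biconing_def)

lemma T_disjoint: "edges R \<inter> T = {}"
  by (auto simp: edges_R T_eq)

lemma finite_A: "finite A" and finite_B: "finite B"
  using finite_G A B by (auto simp: finite_multigraph_def intro: finite_subset)

lemma ends_G: "e \<in> edges G \<Longrightarrow> x \<in> ends G e \<Longrightarrow> x \<in> verts G"
  using finite_G by (auto simp: finite_multigraph_def)

lemma card_bicone_ends: "e \<in> edges H \<Longrightarrow> card (bicone_ends G e) \<in> {1, 2}"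
proof (cases e)
  case (Edge f)
  assume "e \<in> edges H"
  then have "f \<in> edges G" using Edge by (auto simp: H_def biconing_def)
  then have "card (ends G f) \<in> {1, 2}" using finite_G unfolding finite_multigraph_def by blast
  then show ?thesis using Edge by (simp add: card_image inj_on_def)
qed auto

lemma finite_H: "finite_multigraph H"
proof -
  have "bicone_ends G e \<subseteq> verts H" if "e \<in> edges H" for e
    using that A B ends_G by (auto simp: H_def biconing_def)
  moreover have "finite (verts H)" "finite (edges H)"
    using finite_G finite_A finite_B by (auto simp: finite_multigraph_def H_def biconing_def)
  ultimately show ?thesis
    using card_bicone_ends unfolding finite_multigraph_def ends_H by blast
qed

lemma finite_R: "finite_multigraph R"
proof -
  have "bicone_ends G e \<subseteq> verts R" if "e \<in> edges R" for e
    using that A ends_G by (auto simp: edges_R verts_R)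
  moreover have "finite (verts R)" "finite (edges R)"
    using finite_H by (auto simp: finite_multigraph_def edges_H verts_R verts_H)
  ultimately show ?thesis
    using card_bicone_ends unfolding finite_multigraph_def ends_R edges_H by blast
qed

lemma finite_T: "finite T"
  using finite_A finite_B by (simp add: T_eq)

text \<open>Each vertex other than \<open>Zero\<close> has exactly one tree edge leading to it from
  the direction of \<open>Zero\<close>. Since \<open>T\<close> is acyclic as well, this number is
  the rank.\<close>

lemma card_T: "card T = card (verts R)"
proof -
  have "card T = 1 + (card A + card (B - A))"
    unfolding T_eq using finite_A finite_B
    by (subst card_Un_disjoint; (subst card_Un_disjoint)?) (auto simp: card_image inj_on_def)
  also have "card A + card (B - A) = card (verts G)"
    using AB finite_A finite_B by (subst card_Un_disjoint[symmetric]) auto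
  also have "1 + card (verts G) = card (verts R)"
    unfolding verts_R using finite_G
    by (subst card_insert_disjoint) (auto simp: finite_multigraph_def card_image inj_on_def)
  finally show ?thesis .
qed

lemma conn_H_eq_conn_R: "conn H F x y \<longleftrightarrow> conn R F x y"
  by (simp add: adjacency_cong_ends[of H R])

lemma acyclic_H_iff_R: "F \<subseteq> edges R \<Longrightarrow> acyclic_edges H F \<longleftrightarrow> acyclic_edges R F"
  using acyclic_edges_iff_bridges[OF finite_H, of F] acyclic_edges_iff_bridges[OF finite_R, of F]
  by (simp add: conn_H_eq_conn_R edges_H le_supI1)

text \<open>By \<open>A \<union> B = verts G\<close> the vertices of the reduced graph are
  partitioned into \<open>ZA\<close> and the other class in the definition of
  \<open>crossing\<close>.\<close>

lemma crossing_iff: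
  assumes "e \<in> edges R" "ends R e = {u, v}"
  shows "crossing G A B e \<longleftrightarrow> (u \<in> ZA) \<noteq> (v \<in> ZA)"
proof -
  have uv: "u \<in> verts R" "v \<in> verts R"
    using assms finite_R unfolding finite_multigraph_def by (metis insert_subset)+
  have "x \<in> ZA \<or> x \<in> Vertex ` (B - A) \<union> {ZeroBar}" if "x \<in> verts R" for x
    using that AB by (auto simp: verts_R ZA_def)
  moreover have "x \<notin> ZA" if "x \<in> Vertex ` (B - A) \<union> {ZeroBar}" for x
    using that by (auto simp: ZA_def)
  ultimately show ?thesis
    unfolding crossing_def R_def[symmetric] assms(2) ZA_def[symmetric] doubleton_eq_iff
    using uv by metis
qed

lemma conn_in_R: "F \<subseteq> edges R \<Longrightarrow> conn R F x y \<Longrightarrow> x \<in> verts R \<Longrightarrow> y \<in> verts R"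
  using conn_verts[OF finite_R] by blast

end

text \<open>In the biconing, a tree component attached by its edges in X both to Zero and to ZeroBar acts as
  a link between these two vertices, and so does an edge joining Zero to the component of ZeroBar.\<close>

locale biconed_forest = biconed G A B
  for G :: "('v, 'e) multigraph" and A B +
  fixes F :: "('v, 'e) bicone_edge set"
  assumes F: "F \<subseteq> edges R" and acyclic_F: "acyclic_edges R F"

sublocale biconed_forest \<subseteq> forest R F
  using finite_R F acyclic_F by unfold_locales

context biconed_forest
begin

text \<open>A connection from \<open>Zero\<close> to \<open>ZeroBar\<close> is represented by its
  edge at \<open>Zero\<close>, so that having at most one connection becomes the equality of any two
  such edges.\<close>

definition link :: "('v, 'e) bicone_edge set \<Rightarrow> ('v, 'e) bicone_edge \<Rightarrow> bool" where
  "link X e \<longleftrightarrow> e \<in> X \<and> (e = ConeEdge \<or> (\<exists>u. e = EdgeA u \<and>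
     (conn R F ZeroBar (Vertex u) \<or> (\<exists>v. EdgeB v \<in> X \<and> conn R F (Vertex u) (Vertex v)))))"

text \<open>No component of \<open>F\<close> is attached twice to \<open>Zero\<close> or twice to
  \<open>ZeroBar\<close>, where the component of \<open>ZeroBar\<close> counts as attached to
  \<open>ZeroBar\<close> already, and \<open>Zero\<close> and \<open>ZeroBar\<close> are connected
  in at most one way.\<close>

definition one_link :: "('v, 'e) bicone_edge set \<Rightarrow> bool" where
  "one_link X \<longleftrightarrow>
    (\<forall>v. EdgeB v \<in> X \<longrightarrow> \<not> conn R F ZeroBar (Vertex v)) \<and>
    (\<forall>u u'. EdgeA u \<in> X \<and> EdgeA u' \<in> X \<and> conn R F (Vertex u) (Vertex u') \<longrightarrow> u = u') \<and>
    (\<forall>v v'. EdgeB v \<in> X \<and> EdgeB v' \<in> X \<and> conn R F (Vertex v) (Vertex v') \<longrightarrow> v = v') \<and>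
    (\<forall>e e'. link X e \<and> link X e' \<longrightarrow> e = e')"

lemma not_conn_Zero:
  assumes "x \<in> verts R"
  shows "\<not> conn R F x Zero"
  using conn_in_R[OF F _ assms] Zero_R by blast

lemma tree_edge_verts:
  "X \<subseteq> T \<Longrightarrow> EdgeA u \<in> X \<Longrightarrow> Vertex u \<in> verts R"
  "X \<subseteq> T \<Longrightarrow> EdgeB v \<in> X \<Longrightarrow> Vertex v \<in> verts R"
  using A B by (auto simp: T_eq verts_R)

lemma tree_edge_cases:
  assumes "X \<subseteq> T" "e \<in> X"
  obtains "e = ConeEdge" | u where "e = EdgeA u" | v where "e = EdgeB v"
  using assms by (auto simp: T_eq)

text \<open>Each violation of \<open>one_link\<close> provides a detour around some edge of
  \<open>X\<close>.\<close>

lemma one_link_if_bridges: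
  assumes X: "X \<subseteq> T"
    and b: "\<And>e x y. e \<in> X \<Longrightarrow> bicone_ends G e = {x, y} \<Longrightarrow> \<not> conn R (F \<union> X - {e}) x y"
  shows "one_link X"
proof -
  have cF: "conn R (F \<union> X - {e}) x y" if "conn R F x y" "e \<in> X" for e x y
    using that X F T_disjoint by (intro conn_mono[OF that(1)]) blast
  have cX: "conn R (F \<union> X - {e}) x y" if "f \<in> X" "f \<noteq> e" "bicone_ends G f = {x, y}" for e f x y
    using that by (intro conn_edge[of f]) auto
  \<comment> \<open>The part of a link between \<open>ZeroBar\<close> and the component uses no edge
    at \<open>Zero\<close>. It thus remains intact when any \<open>e\<close> of \<open>X\<close>
    that is not an \<open>EdgeB\<close> is removed, including the edge of the link itself.\<close>
  have link_far: "conn R (F \<union> X - {e}) ZeroBar (Vertex u)"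
    if l: "link X (EdgeA u)" "e \<in> X" "\<And>v. e \<noteq> EdgeB v" for e u
  proof -
    consider "conn R F ZeroBar (Vertex u)" |
      v where "EdgeB v \<in> X" "conn R F (Vertex u) (Vertex v)"
      using l(1) by (auto simp: link_def)
    then show ?thesis
    proof cases
      case 1
      then show ?thesis using cF l(2) by blast
    next
      case 2
      have "conn R (F \<union> X - {e}) ZeroBar (Vertex v)" using cX[OF 2(1), of e ZeroBar "Vertex v"] l(3)[of v] by auto
      moreover have "conn R (F \<union> X - {e}) (Vertex v) (Vertex u)"
        using cF[OF 2(2) l(2)] conn_sym by metis
      ultimately show ?thesis by (rule rtrancl_trans)
    qed
  qed
  have link_type: "e = ConeEdge \<or> (\<exists>u. e = EdgeA u)" if "link X e" for e
    using that by (auto simp: link_def)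
  show ?thesis
    unfolding one_link_def
  proof (intro conjI allI impI)
    fix v assume v: "EdgeB v \<in> X"
    show "\<not> conn R F ZeroBar (Vertex v)" using cF[OF _ v] b[OF v] by auto
  next
    fix u u' assume u: "EdgeA u \<in> X \<and> EdgeA u' \<in> X \<and> conn R F (Vertex u) (Vertex u')"
    show "u = u'"
    proof (rule ccontr)
      assume "u \<noteq> u'"
      then have "conn R (F \<union> X - {EdgeA u}) Zero (Vertex u')"
        using u by (intro cX[of "EdgeA u'"]) auto
      moreover have "conn R (F \<union> X - {EdgeA u}) (Vertex u') (Vertex u)" using u cF conn_sym by metis
      ultimately have "conn R (F \<union> X - {EdgeA u}) Zero (Vertex u)" by (rule rtrancl_trans)
      then show False using b[of "EdgeA u" Zero "Vertex u"] u by auto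
    qed
  next
    fix u u' assume u: "EdgeB u \<in> X \<and> EdgeB u' \<in> X \<and> conn R F (Vertex u) (Vertex u')"
    show "u = u'"
    proof (rule ccontr)
      assume "u \<noteq> u'"
      then have "conn R (F \<union> X - {EdgeB u}) ZeroBar (Vertex u')"
        using u by (intro cX[of "EdgeB u'"]) auto
      moreover have "conn R (F \<union> X - {EdgeB u}) (Vertex u') (Vertex u)" using u cF conn_sym by metis
      ultimately have "conn R (F \<union> X - {EdgeB u}) ZeroBar (Vertex u)" by (rule rtrancl_trans)
      then show False using b[of "EdgeB u" ZeroBar "Vertex u"] u by auto
    qed
  next
    fix e f assume ef: "link X e \<and> link X f"
    then have X': "e \<in> X" "f \<in> X" by (auto simp: link_def)
    have nB: "e \<noteq> EdgeB v" for v using link_type ef by blast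
    show "e = f"
    proof (rule ccontr)
      assume "e \<noteq> f"
      \<comment> \<open>The second link still joins \<open>Zero\<close> to \<open>ZeroBar\<close>
        without \<open>e\<close>; together with the rest of the first link it is a detour around
        \<open>e\<close>.\<close>
      have f: "conn R (F \<union> X - {e}) Zero ZeroBar"
      proof (cases "f = ConeEdge")
        case True
        then show ?thesis using cX[OF X'(2)] \<open>e \<noteq> f\<close> by auto
      next
        case False
        then obtain u where u: "f = EdgeA u" using link_type ef by blast
        have "conn R (F \<union> X - {e}) Zero (Vertex u)" using cX[OF X'(2)] \<open>e \<noteq> f\<close> u by auto
        moreover have "conn R (F \<union> X - {e}) (Vertex u) ZeroBar"
          using link_far X'(1) nB ef u conn_sym by metis
        ultimately show ?thesis by (rule rtrancl_trans)
      qed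
      show False
      proof (cases "e = ConeEdge")
        case True
        then show ?thesis using f b[OF X'(1)] by auto
      next
        case False
        then obtain u where u: "e = EdgeA u" using link_type ef by blast
        have "conn R (F \<union> X - {e}) ZeroBar (Vertex u)" using link_far X'(1) nB ef u by metis
        then have "conn R (F \<union> X - {e}) Zero (Vertex u)" using f by (rule_tac rtrancl_trans)
        then show ?thesis using b[OF X'(1)] u by auto
      qed
    qed
  qed
qed

text \<open>Two closed sets witness the separation. If \<open>e\<close> is part of the link, no link
  remains without it, and the side of \<open>ZeroBar\<close> cannot reach \<open>Zero\<close>. If
  not, then \<open>e\<close> is the only tree edge at its component of \<open>F\<close>, which
  becomes isolated.\<close>

lemma bridge_if_one_link:
  assumes X: "X \<subseteq> T" and ol: "one_link X" and e: "e \<in> X" and xy: "bicone_ends G e = {x, y}"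
  shows "\<not> conn R (F \<union> X - {e}) x y"
proof -
  have ol1: "EdgeB v \<in> X \<Longrightarrow> \<not> conn R F ZeroBar (Vertex v)" for v
    using ol by (auto simp: one_link_def)
  have ol2: "EdgeA u \<in> X \<Longrightarrow> EdgeA u' \<in> X \<Longrightarrow> conn R F (Vertex u) (Vertex u') \<Longrightarrow> u = u'" for u u'
    using ol by (auto simp: one_link_def)
  have ol3: "EdgeB u \<in> X \<Longrightarrow> EdgeB u' \<in> X \<Longrightarrow> conn R F (Vertex u) (Vertex u') \<Longrightarrow> u = u'" for u u'
    using ol by (auto simp: one_link_def)
  have ol4: "link X f \<Longrightarrow> link X f' \<Longrightarrow> f = f'" for f f'
    using ol by (auto simp: one_link_def)
  have link_mono: "link (X - {e}) f \<Longrightarrow> link X f" for f by (auto simp: link_def)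
  \<comment> \<open>\<open>Y\<close> is the side of \<open>ZeroBar\<close>: its component in
    \<open>F\<close>, and the components attached to it by a remaining \<open>EdgeB\<close>. It is
    closed as long as no link is left.\<close>
  define Y where "Y = {z. conn R F ZeroBar z \<or> (\<exists>v. EdgeB v \<in> X - {e} \<and> conn R F z (Vertex v))}"
  have ZY: "ZeroBar \<in> Y" "Zero \<notin> Y"
    
    using not_conn_Zero ZeroBar_R tree_edge_verts(2)[OF X]
    by (auto simp: Y_def) (metis conn_sym)
  have Y_closed: "z' \<in> Y"
    if "conn R (F \<union> X - {e}) z z'" "z \<in> Y" and nl: "\<And>f. \<not> link (X - {e}) f" for z z'
  proof (rule conn_closed[OF that(1,2)])
    fix f x y assume f: "f \<in> F \<union> X - {e}" "ends R f = {x, y}" "x \<in> Y"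
    show "y \<in> Y"
    proof (cases "f \<in> F")
      case True
      then have "conn R F x y" "conn R F y x"
        using f conn_edge[of f F R x y] conn_edge[of f F R y x] by (simp_all add: insert_commute)
      then show ?thesis using f(3) unfolding Y_def by (auto intro: rtrancl_trans)
    next
      case False
      then have fX: "f \<in> X - {e}" using f by auto
      then have "f \<in> X" by simp
      with X show ?thesis
      proof (cases rule: tree_edge_cases)
        case 1
        then show ?thesis using nl[of f] fX by (auto simp: link_def)
      next
        case (2 u)
        then have "x = Vertex u" using f ZY by (auto simp: doubleton_eq_iff)
        then have "link (X - {e}) f" using f(3) 2 fX unfolding link_def Y_def by auto
        then show ?thesis using nl by blast
      next
        case (3 v)
        then show ?thesis using f fX ZY by (auto simp: doubleton_eq_iff Y_def)
      qed
    qed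
  qed
  \<comment> \<open>A component of \<open>F\<close> without \<open>ZeroBar\<close> and without
    remaining tree edges is not enlarged by the other edges.\<close>
  have K_closed: "conn R F (Vertex u) z"
    if "conn R (F \<union> X - {e}) (Vertex u) z" "\<not> conn R F (Vertex u) ZeroBar" "Vertex u \<in> verts R"
      "\<And>v. EdgeA v \<in> X - {e} \<Longrightarrow> \<not> conn R F (Vertex u) (Vertex v)"
      "\<And>v. EdgeB v \<in> X - {e} \<Longrightarrow> \<not> conn R F (Vertex u) (Vertex v)" for u z
  proof -
    have "z \<in> {z. conn R F (Vertex u) z}"
    proof (rule conn_closed[OF that(1)])
      fix f x y assume f: "f \<in> F \<union> X - {e}" "ends R f = {x, y}" "x \<in> {z. conn R F (Vertex u) z}"
      show "y \<in> {z. conn R F (Vertex u) z}"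
      proof (cases "f \<in> F")
        case True
        then have "conn R F x y" using f by (intro conn_edge)
        then show ?thesis using f(3) by (auto intro: rtrancl_trans)
      next
        case False
        then have fX: "f \<in> X - {e}" using f by auto
        have "x \<noteq> Zero" "x \<noteq> ZeroBar" using f(3) not_conn_Zero that by auto
        moreover have "f \<in> X" using fX by simp
        with X have "x = Zero \<or> x = ZeroBar \<or> (\<exists>v. x = Vertex v \<and> (EdgeA v \<in> X - {e} \<or> EdgeB v \<in> X - {e}))"
          by (cases rule: tree_edge_cases) (use f fX in \<open>auto simp: doubleton_eq_iff\<close>)
        ultimately show ?thesis using f(3) that(4,5) by auto
      qed
    qed simp
    then show ?thesis by simp
  qed
  have *: "\<not> conn R (F \<union> X - {e}) p q" if "\<not> conn R (F \<union> X - {e}) q p" for p q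
    using that conn_sym by metis
  from X e show ?thesis
  proof (cases rule: tree_edge_cases)
    case 1
    then have "link X e" using e by (auto simp: link_def)
    then have "\<not> link (X - {e}) f" for f using ol4 link_mono by (metis Diff_iff insertI1 link_def)
    then have "\<not> conn R (F \<union> X - {e}) ZeroBar Zero" using Y_closed ZY by metis
    then show ?thesis using xy 1 * by (auto simp: doubleton_eq_iff)
  next
    case (2 u)
    have "\<not> conn R (F \<union> X - {e}) (Vertex u) Zero"
    proof (cases "link X e")
      case True
      then have "\<not> link (X - {e}) f" for f using ol4 link_mono by (metis Diff_iff insertI1 link_def)
      moreover have "Vertex u \<in> Y" using True 2 unfolding link_def Y_def by auto
      ultimately show ?thesis using Y_closed ZY by metis
    next
      case False
      have u: "Vertex u \<in> verts R" using tree_edge_verts(1)[OF X] e 2 by blast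
      show ?thesis
      proof
        assume c: "conn R (F \<union> X - {e}) (Vertex u) Zero"
        have "conn R F (Vertex u) Zero"
        proof (rule K_closed[OF c _ u])
          show "\<not> conn R F (Vertex u) ZeroBar" 
            using False e 2 conn_sym[of "Vertex u" ZeroBar R F] unfolding link_def by auto
          show "\<not> conn R F (Vertex u) (Vertex v)" if "EdgeA v \<in> X - {e}" for v
            using that ol2[of u v] e 2 by auto
          show "\<not> conn R F (Vertex u) (Vertex v)" if "EdgeB v \<in> X - {e}" for v
            using that False e 2 unfolding link_def by auto
        qed
        then show False using not_conn_Zero[OF u] by simp
      qed
    qed
    then show ?thesis using xy 2 * by (auto simp: doubleton_eq_iff)
  next
    case (3 v)
    have v: "Vertex v \<in> verts R" "EdgeB v \<in> X" using tree_edge_verts(2)[OF X] e 3 by blast+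
    have "\<not> conn R (F \<union> X - {e}) ZeroBar (Vertex v)"
    \<comment> \<open>If the component of \<open>v\<close> also has an \<open>EdgeA\<close>, then
      \<open>e\<close> completes the unique link, and removing \<open>e\<close> leaves none.
      Otherwise \<open>e\<close> is its only tree edge.\<close>
    proof (cases "\<exists>u. EdgeA u \<in> X \<and> conn R F (Vertex u) (Vertex v)")
      case True
      then obtain u where u: "EdgeA u \<in> X" "conn R F (Vertex u) (Vertex v)" by blast
      then have "link X (EdgeA u)" using v unfolding link_def by blast
      have "\<not> link (X - {e}) f" for f
      proof
        assume l: "link (X - {e}) f"
        then have "f = EdgeA u" using ol4 link_mono \<open>link X (EdgeA u)\<close> by blast
        then consider "conn R F ZeroBar (Vertex u)" |
          v' where "EdgeB v' \<in> X" "v' \<noteq> v" "conn R F (Vertex u) (Vertex v')"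
          using l 3 by (auto simp: link_def)
        then show False
        proof cases
          case 1
          then show False using ol1[OF v(2)] u(2) by (meson rtrancl_trans)
        next
          case 2
          then show False using ol3[OF v(2), of v'] u(2) conn_sym by (metis rtrancl_trans)
        qed
      qed
      moreover have "Vertex v \<notin> Y"
        using ol1[OF v(2)] ol3[OF v(2)] 3 by (auto simp: Y_def)
      ultimately show ?thesis using Y_closed ZY by metis
    next
      case False
      show ?thesis
      proof
        assume "conn R (F \<union> X - {e}) ZeroBar (Vertex v)"
        then have c: "conn R (F \<union> X - {e}) (Vertex v) ZeroBar" by (rule conn_sym)
        have "conn R F (Vertex v) ZeroBar"
        proof (rule K_closed[OF c _ v(1)])
          show "\<not> conn R F (Vertex v) ZeroBar" using ol1[OF v(2)] conn_sym by metis
          show "\<not> conn R F (Vertex v) (Vertex w)" if "EdgeA w \<in> X - {e}" for w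
            using that False conn_sym by (metis Diff_iff)
          show "\<not> conn R F (Vertex v) (Vertex w)" if "EdgeB w \<in> X - {e}" for w
            using that ol3[OF v(2), of w] 3 by auto
        qed
        then show False using ol1[OF v(2)] conn_sym by metis
      qed
    qed
    then show ?thesis using xy 3 * by (auto simp: doubleton_eq_iff)
  qed
qed

lemma acyclic_iff_one_link:
  assumes "X \<subseteq> T"
  shows "acyclic_edges H (F \<union> X) \<longleftrightarrow> one_link X"
proof -
  have "acyclic_edges H (F \<union> X) \<longleftrightarrow>
      (\<forall>e\<in>X. \<forall>x y. bicone_ends G e = {x, y} \<longrightarrow> \<not> conn R (F \<union> X - {e}) x y)"
    using acyclic_edges_Un_iff[OF finite_H, of F X] F assms acyclic_F acyclic_H_iff_R[OF F]
    by (auto simp: edges_H conn_H_eq_conn_R)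
  then show ?thesis using one_link_if_bridges[OF assms] bridge_if_one_link[OF assms] by blast
qed

end


section \<open>Extending a forest by edges of the tree\<close>

text \<open>For an edge of \<open>T\<close> this is the end farther from \<open>Zero\<close>, the
  child if the tree is rooted there. \<open>Edge e\<close> gets the value \<open>Zero\<close>, which
  is not a vertex of the reduced graph.\<close>

fun tip :: "('v, 'e) bicone_edge \<Rightarrow> 'v bicone_vertex" where
  "tip ConeEdge = ZeroBar"
| "tip (EdgeA u) = Vertex u"
| "tip (EdgeB v) = Vertex v"
| "tip (Edge e) = Zero"

context biconed_forest
begin

definition attached :: "'v bicone_vertex set \<Rightarrow> ('v, 'e) bicone_edge set" where
  "attached S = {e \<in> T. tip e \<in> S}"

text \<open>At the component of \<open>ZeroBar\<close> only the empty choice is possible: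
  \<open>ConeEdge\<close> or an \<open>EdgeA\<close> would be a link, and an \<open>EdgeB\<close>
  would close a cycle.\<close>

definition unlinked :: "'v bicone_vertex set \<Rightarrow> ('v, 'e) bicone_edge set set" where
  "unlinked S = (if ZeroBar \<in> S then {{}} else {X. X \<subseteq> attached S \<and> card X \<le> 1})"

definition linked :: "'v bicone_vertex set \<Rightarrow> ('v, 'e) bicone_edge set set" where
  "linked S = (if ZeroBar \<in> S then (\<lambda>e. {e}) ` {e \<in> attached S. \<forall>v. e \<noteq> EdgeB v}
     else {{EdgeA u, EdgeB v} |u v. EdgeA u \<in> attached S \<and> EdgeB v \<in> attached S})"

lemma finite_attached: "finite (attached S)"
  using finite_T by (simp add: attached_def)

lemma ConeEdge_attached: "ConeEdge \<in> attached S \<longleftrightarrow> ZeroBar \<in> S"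
  by (auto simp: attached_def T_eq)

lemma attached_cases:
  assumes "e \<in> attached S"
  obtains "e = ConeEdge" | u where "e = EdgeA u" | v where "e = EdgeB v"
  using assms by (auto simp: attached_def T_eq)

lemma attached_cases_nonroot:
  assumes "e \<in> attached S" "ZeroBar \<notin> S"
  shows "(\<exists>u. e = EdgeA u) \<or> (\<exists>v. e = EdgeB v)"
  using assms(1) by (rule attached_cases) (use assms ConeEdge_attached in auto)

lemma tip_T: "tip ` T = verts R" "inj_on tip T"
proof -
  have "tip ` T = insert ZeroBar (Vertex ` (A \<union> (B - A)))"
    unfolding T_eq image_Un image_image by simp
  then show "tip ` T = verts R" using AB by (simp add: verts_R)
qed (auto simp: T_eq inj_on_def)

lemma card_attached: "S \<in> components R F \<Longrightarrow> card (attached S) = card S"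
proof -
  assume "S \<in> components R F"
  then have "S \<subseteq> verts R" using Union_components[OF finite_R F] by auto
  then have "tip ` attached S = S" using tip_T(1) by (auto simp: attached_def)
  moreover have "inj_on tip (attached S)" using tip_T(2) by (rule inj_on_subset) (auto simp: attached_def)
  ultimately show ?thesis by (metis card_image)
qed

lemma Union_attached: "(\<Union>S\<in>components R F. attached S) = T"
  using tip_T(1) Union_components[OF finite_R F] by (fastforce simp: attached_def)

lemma attached_disjoint:
  "S \<in> components R F \<Longrightarrow> S' \<in> components R F \<Longrightarrow> S \<noteq> S' \<Longrightarrow> attached S \<inter> attached S' = {}"
  using components_disjoint by (fastforce simp: attached_def)

lemma unlinked_linked_disjoint: "unlinked S \<inter> linked S = {}"
proof (cases "ZeroBar \<in> S")
  case False
  have "card {EdgeA u, EdgeB v :: ('v, 'e) bicone_edge} = 2" for u v by simp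
  then show ?thesis using False by (auto simp: unlinked_def linked_def)
qed (auto simp: unlinked_def linked_def)

lemma unlinked_linked_subset: "unlinked S \<union> linked S \<subseteq> Pow (attached S)"
  by (auto simp: unlinked_def linked_def)

lemma finite_unlinked: "finite (unlinked S)" and finite_linked: "finite (linked S)"
  using unlinked_linked_subset[of S] finite_attached[of S] by (auto intro: finite_subset)

section \<open>Acyclicity as a condition on each component\<close>

lemma same_component_iff:
  "S \<in> components R F \<Longrightarrow> x \<in> S \<Longrightarrow> y \<in> S \<longleftrightarrow> conn R F x y"
  using component_eq by fast

text \<open>A link through an ordinary component needs an \<open>EdgeA\<close> and an
  \<open>EdgeB\<close> there, one edge too many for \<open>unlinked\<close>; at the component of
  \<open>ZeroBar\<close>, already one edge is too many.\<close>

lemma link_imp_linked: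
  assumes X: "X \<subseteq> T" and S: "S \<in> components R F"
    and loc: "X \<inter> attached S \<in> unlinked S \<union> linked S"
    and l: "link X e" "tip e \<in> S"
  shows "X \<inter> attached S \<in> linked S"
proof (rule ccontr)
  assume "X \<inter> attached S \<notin> linked S"
  then have u: "X \<inter> attached S \<in> unlinked S" using loc by simp
  have e: "e \<in> X \<inter> attached S" using l X by (auto simp: link_def attached_def)
  then have Z: "ZeroBar \<notin> S" using u by (auto simp: unlinked_def)
  then have "e \<noteq> ConeEdge" using l by auto
  then obtain a where a: "e = EdgeA a" "Vertex a \<in> S" using l by (auto simp: link_def)
  then have "\<not> conn R F ZeroBar (Vertex a)"
    using Z same_component_iff[OF S a(2)] conn_sym by metis
  then obtain v where v: "EdgeB v \<in> X" "conn R F (Vertex a) (Vertex v)"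
    using l a by (auto simp: link_def)
  then have "{e, EdgeB v} \<subseteq> X \<inter> attached S"
    using e same_component_iff[OF S a(2)] X by (auto simp: attached_def)
  then have "card {e, EdgeB v} \<le> card (X \<inter> attached S)"
    using finite_attached by (intro card_mono) auto
  then show False using u Z a by (auto simp: unlinked_def)
qed

lemma linked_unique_link:
  assumes "Y \<in> linked S" "e \<in> Y" "e' \<in> Y" "\<And>v. e \<noteq> EdgeB v" "\<And>v. e' \<noteq> EdgeB v"
  shows "e = e'"
  using assms by (auto simp: linked_def split: if_splits)

lemma local_same_type:
  assumes "Y \<in> unlinked S \<union> linked S"
  shows "EdgeA u \<in> Y \<Longrightarrow> EdgeA u' \<in> Y \<Longrightarrow> u = u'"
    and "EdgeB v \<in> Y \<Longrightarrow> EdgeB v' \<in> Y \<Longrightarrow> v = v'"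
proof -
  have *: "e = e'" if "e \<in> Y" "e' \<in> Y" "card Y \<le> 1" "Y \<subseteq> attached S" for e e'
    using that card_le_Suc0_iff_eq[of Y] finite_attached by (metis One_nat_def finite_subset)
  show "EdgeA u \<in> Y \<Longrightarrow> EdgeA u' \<in> Y \<Longrightarrow> u = u'"
    using assms *[of "EdgeA u" "EdgeA u'"] by (auto simp: unlinked_def linked_def split: if_splits)
  show "EdgeB v \<in> Y \<Longrightarrow> EdgeB v' \<in> Y \<Longrightarrow> v = v'"
    using assms *[of "EdgeB v" "EdgeB v'"] by (auto simp: unlinked_def linked_def split: if_splits)
qed

lemma local_EdgeB:
  "Y \<in> unlinked S \<union> linked S \<Longrightarrow> EdgeB v \<in> Y \<Longrightarrow> ZeroBar \<notin> S"
  by (auto simp: unlinked_def linked_def)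

lemma component_of_tip:
  assumes "X \<subseteq> T" "e \<in> X"
  obtains S where "S \<in> components R F" "tip e \<in> S" "e \<in> X \<inter> attached S"
proof -
  have "e \<in> (\<Union>S\<in>components R F. attached S)" using assms Union_attached by auto
  then show ?thesis using that assms by (auto simp: attached_def)
qed

text \<open>Tree edges with connected tips are attached to the same component, where the local
  choice excludes conflicts. Two links lie in linked components, hence in the same one, which has
  only one edge at \<open>Zero\<close>.\<close>

lemma one_link_if_local:
  assumes X: "X \<subseteq> T"
    and loc: "\<And>S. S \<in> components R F \<Longrightarrow> X \<inter> attached S \<in> unlinked S \<union> linked S"
    and one: "card {S \<in> components R F. X \<inter> attached S \<in> linked S} \<le> 1"
  shows "one_link X"
  unfolding one_link_def
proof (intro conjI allI impI)
  fix v assume v: "EdgeB v \<in> X"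
  obtain S where S: "S \<in> components R F" "Vertex v \<in> S" "EdgeB v \<in> X \<inter> attached S"
    using component_of_tip[OF X v] by auto
  have "ZeroBar \<notin> S" using local_EdgeB[OF loc[OF S(1)] S(3)] .
  then show "\<not> conn R F ZeroBar (Vertex v)"
    using same_component_iff[OF S(1,2)] conn_sym by metis
next
  fix u u' assume u: "EdgeA u \<in> X \<and> EdgeA u' \<in> X \<and> conn R F (Vertex u) (Vertex u')"
  then obtain S where S: "S \<in> components R F" "Vertex u \<in> S" "EdgeA u \<in> X \<inter> attached S"
    using component_of_tip[OF X, of "EdgeA u"] by auto
  have "EdgeA u' \<in> X \<inter> attached S"
    using u same_component_iff[OF S(1,2)] X by (auto simp: attached_def)
  then show "u = u'" using local_same_type(1)[OF loc[OF S(1)] S(3)] by blast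
next
  fix u u' assume u: "EdgeB u \<in> X \<and> EdgeB u' \<in> X \<and> conn R F (Vertex u) (Vertex u')"
  then obtain S where S: "S \<in> components R F" "Vertex u \<in> S" "EdgeB u \<in> X \<inter> attached S"
    using component_of_tip[OF X, of "EdgeB u"] by auto
  have "EdgeB u' \<in> X \<inter> attached S"
    using u same_component_iff[OF S(1,2)] X by (auto simp: attached_def)
  then show "u = u'" using local_same_type(2)[OF loc[OF S(1)] S(3)] by blast
next
  fix e e' assume l: "link X e \<and> link X e'"
  then have inX: "e \<in> X" "e' \<in> X" and nB: "\<And>v. e \<noteq> EdgeB v" "\<And>v. e' \<noteq> EdgeB v"
    by (auto simp: link_def)
  obtain S where S: "S \<in> components R F" "tip e \<in> S" "e \<in> X \<inter> attached S"
    using component_of_tip[OF X inX(1)] .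
  obtain S' where S': "S' \<in> components R F" "tip e' \<in> S'" "e' \<in> X \<inter> attached S'"
    using component_of_tip[OF X inX(2)] .
  have L: "X \<inter> attached S \<in> linked S" "X \<inter> attached S' \<in> linked S'"
    using link_imp_linked[OF X S(1) loc[OF S(1)] _ S(2)] link_imp_linked[OF X S'(1) loc[OF S'(1)] _ S'(2)] l
    by auto
  have "finite {S \<in> components R F. X \<inter> attached S \<in> linked S}"
    using finite_components[OF finite_verts] by simp
  then have "S = S'" using one L S(1) S'(1) card_le_Suc0_iff_eq by (metis (mono_tags, lifting) One_nat_def mem_Collect_eq)
  then show "e = e'" using linked_unique_link[OF L(1) S(3) _ nB] S'(3) by simp
qed

lemma linked_imp_link:
  assumes X: "X \<subseteq> T" and S: "S \<in> components R F" and L: "X \<inter> attached S \<in> linked S"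
  obtains e where "link X e" "tip e \<in> S"
proof (cases "ZeroBar \<in> S")
  case True
  then obtain e where e: "X \<inter> attached S = {e}" "e \<in> attached S" "\<And>v. e \<noteq> EdgeB v"
    using L by (auto simp: linked_def)
  then have "e \<in> X" "tip e \<in> S" by (auto simp: attached_def)
  moreover have "conn R F ZeroBar (tip e)" using same_component_iff[OF S True] \<open>tip e \<in> S\<close> by simp
  ultimately have "link X e"
    using e(3) by (cases rule: attached_cases[OF e(2)]) (auto simp: link_def)
  then show ?thesis using that \<open>tip e \<in> S\<close> by blast
next
  case False
  then obtain u v where uv: "X \<inter> attached S = {EdgeA u, EdgeB v}"
    using L by (auto simp: linked_def)
  then have in_S: "EdgeA u \<in> X" "EdgeB v \<in> X" "Vertex u \<in> S" "Vertex v \<in> S"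
    by (auto simp: attached_def dest!: equalityD1 equalityD2)
  then have "link X (EdgeA u)"
    using same_component_iff[OF S in_S(3)] by (auto simp: link_def)
  then show ?thesis using that in_S by auto
qed

lemma local_if_one_link:
  assumes X: "X \<subseteq> T" and ol: "one_link X"
  shows "\<And>S. S \<in> components R F \<Longrightarrow> X \<inter> attached S \<in> unlinked S \<union> linked S"
    and "card {S \<in> components R F. X \<inter> attached S \<in> linked S} \<le> 1"
proof -
  have ol1: "EdgeB v \<in> X \<Longrightarrow> \<not> conn R F ZeroBar (Vertex v)" for v
    using ol by (auto simp: one_link_def)
  have ol2: "EdgeA u \<in> X \<Longrightarrow> EdgeA u' \<in> X \<Longrightarrow> conn R F (Vertex u) (Vertex u') \<Longrightarrow> u = u'" for u u'
    using ol by (auto simp: one_link_def)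
  have ol3: "EdgeB u \<in> X \<Longrightarrow> EdgeB u' \<in> X \<Longrightarrow> conn R F (Vertex u) (Vertex u') \<Longrightarrow> u = u'" for u u'
    using ol by (auto simp: one_link_def)
  have ol4: "link X f \<Longrightarrow> link X f' \<Longrightarrow> f = f'" for f f'
    using ol by (auto simp: one_link_def)
  show "X \<inter> attached S \<in> unlinked S \<union> linked S" if S: "S \<in> components R F" for S
  proof (cases "ZeroBar \<in> S")
    case True
    have nB: "e \<noteq> EdgeB v" if "e \<in> X \<inter> attached S" for e v
    proof
      assume "e = EdgeB v"
      then have "EdgeB v \<in> X" "Vertex v \<in> S" using that by (auto simp: attached_def)
      then show False using ol1 same_component_iff[OF S True] by simp
    qed
    have lk: "link X e" if e: "e \<in> X \<inter> attached S" for e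
    proof -
      have "conn R F ZeroBar (tip e)" using same_component_iff[OF S True] e by (auto simp: attached_def)
      moreover have at: "e \<in> attached S" using e by simp
      ultimately show ?thesis using e nB[OF e] by (cases rule: attached_cases[OF at]) (auto simp: link_def)
    qed
    show ?thesis
    proof (cases "X \<inter> attached S = {}")
      case False
      then obtain e where e: "e \<in> X \<inter> attached S" by blast
      then have "X \<inter> attached S = {e}" using ol4 lk by blast
      then show ?thesis using True e nB[OF e] by (auto simp: linked_def)
    qed (use True in \<open>simp add: unlinked_def\<close>)
  next
    case False
    have cn: "conn R F (tip e) (tip e')" if "e \<in> attached S" "e' \<in> attached S" for e e'
      using that same_component_iff[OF S] by (auto simp: attached_def)
    \<comment> \<open>An ordinary component has at most one \<open>EdgeA\<close> and at most one
      \<open>EdgeB\<close>. The choice there is thus a pair of both kinds or has at most one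
      edge.\<close>
    have same: "e = e'" if i: "e \<in> X \<inter> attached S" "e' \<in> X \<inter> attached S"
      "(\<exists>u. e = EdgeA u) \<longleftrightarrow> (\<exists>u. e' = EdgeA u)" for e e'
    proof -
      have at: "e \<in> attached S" "e' \<in> attached S" "e \<in> X" "e' \<in> X" using i by auto
      then consider u v where "e = EdgeA u" "e' = EdgeA v" | u v where "e = EdgeB u" "e' = EdgeB v"
        using i(3) attached_cases_nonroot[OF _ False] by metis
      then show ?thesis using ol2 ol3 cn[OF at(1,2)] at(3,4) by cases simp_all
    qed
    show ?thesis
    proof (cases "\<exists>u v. EdgeA u \<in> X \<inter> attached S \<and> EdgeB v \<in> X \<inter> attached S")
      case True
      then obtain u v where uv: "EdgeA u \<in> X \<inter> attached S" "EdgeB v \<in> X \<inter> attached S" by blast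
      have "X \<inter> attached S = {EdgeA u, EdgeB v}"
        using uv same[OF _ uv(1)] same[OF _ uv(2)] by blast
      then show ?thesis using uv False by (auto simp: linked_def)
    next
      case False': False
      have "e = e'" if e: "e \<in> X \<inter> attached S" "e' \<in> X \<inter> attached S" for e e'
      proof (rule same[OF e])
        have "e \<in> attached S" "e' \<in> attached S" using e by auto
        then show "(\<exists>u. e = EdgeA u) \<longleftrightarrow> (\<exists>u. e' = EdgeA u)"
          using e False' attached_cases_nonroot[OF _ False] by metis
      qed
      then have "card (X \<inter> attached S) \<le> 1"
        using card_le_Suc0_iff_eq[of "X \<inter> attached S"] finite_attached by (metis One_nat_def finite_Int)
      then show ?thesis using False by (simp add: unlinked_def)
    qed
  qed
  have "S = S'" if i: "S \<in> components R F" "X \<inter> attached S \<in> linked S"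
    "S' \<in> components R F" "X \<inter> attached S' \<in> linked S'" for S S'
  proof -
    obtain e where e: "link X e" "tip e \<in> S" using linked_imp_link[OF X i(1,2)] .
    obtain e' where e': "link X e'" "tip e' \<in> S'" using linked_imp_link[OF X i(3,4)] .
    show ?thesis using ol4[OF e(1) e'(1)] e(2) e'(2) components_disjoint i by metis
  qed
  then show "card {S \<in> components R F. X \<inter> attached S \<in> linked S} \<le> 1"
    using finite_components[OF finite_verts] by (subst One_nat_def, subst card_le_Suc0_iff_eq) auto
qed

text \<open>An instance of \<open>sum_at_most_one_special\<close>, with \<open>unlinked\<close> as
  the normal and \<open>linked\<close> as the special choices at each component.\<close>

lemma sum_acyclic_extensions:
  fixes y :: "'a :: comm_semiring_1"
  shows "(\<Sum>X\<in>{X. X \<subseteq> T \<and> acyclic_edges H (F \<union> X)}. y ^ card X) =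
    (\<Prod>S\<in>components R F. \<Sum>X\<in>unlinked S. y ^ card X) +
    (\<Sum>S\<in>components R F. (\<Sum>X\<in>linked S. y ^ card X) *
      (\<Prod>S'\<in>components R F - {S}. \<Sum>X\<in>unlinked S'. y ^ card X))"
proof -
  let ?C = "components R F"
  let ?p = "\<lambda>X. \<lambda>S\<in>?C. X \<inter> attached S"
  let ?X = "{X. X \<subseteq> (\<Union>S\<in>?C. attached S) \<and> (\<forall>S\<in>?C. X \<inter> attached S \<in> unlinked S \<union> linked S)}"
  have fin: "finite ?C" using finite_components[OF finite_verts] .
  have "{X. X \<subseteq> T \<and> acyclic_edges H (F \<union> X)} = {X \<in> ?X. card {S \<in> ?C. ?p X S \<in> linked S} \<le> 1}"
  proof -
    have "acyclic_edges H (F \<union> X) \<longleftrightarrow> (\<forall>S\<in>?C. X \<inter> attached S \<in> unlinked S \<union> linked S) \<and>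
        card {S \<in> ?C. ?p X S \<in> linked S} \<le> 1" if X: "X \<subseteq> T" for X
    proof -
      have "{S \<in> ?C. ?p X S \<in> linked S} = {S \<in> ?C. X \<inter> attached S \<in> linked S}" by auto
      then show ?thesis
        unfolding acyclic_iff_one_link[OF X]
        using one_link_if_local[OF X] local_if_one_link[OF X] by (intro iffI conjI ballI) simp_all
    qed
    then show ?thesis unfolding Union_attached by blast
  qed
  moreover have "y ^ card X = (\<Prod>S\<in>?C. y ^ card (?p X S))"
    if "X \<in> {X \<in> ?X. card {S \<in> ?C. ?p X S \<in> linked S} \<le> 1}" for X
  proof -
    have "X = (\<Union>S\<in>?C. X \<inter> attached S)" using that by auto
    then have "card X = card (\<Union>S\<in>?C. X \<inter> attached S)" by simp
    also have "\<dots> = (\<Sum>S\<in>?C. card (X \<inter> attached S))"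
      using fin finite_attached attached_disjoint by (intro card_UN_disjoint) blast+
    finally have "card X = (\<Sum>S\<in>?C. card (X \<inter> attached S))" .
    then show ?thesis by (simp add: power_sum)
  qed
  ultimately have "(\<Sum>X\<in>{X. X \<subseteq> T \<and> acyclic_edges H (F \<union> X)}. y ^ card X) =
      (\<Sum>X\<in>{X \<in> ?X. card {S \<in> ?C. ?p X S \<in> linked S} \<le> 1}. \<Prod>S\<in>?C. y ^ card (?p X S))"
    by (intro sum.cong) auto
  also have "\<dots> = (\<Prod>S\<in>?C. \<Sum>X\<in>unlinked S. y ^ card X) +
      (\<Sum>S\<in>?C. (\<Sum>X\<in>linked S. y ^ card X) * (\<Prod>S'\<in>?C - {S}. \<Sum>X\<in>unlinked S'. y ^ card X))"
    using attached_disjoint unlinked_linked_subset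
    by (intro sum_at_most_one_special[where f = "\<lambda>S X. y ^ card X"] fin finite_unlinked finite_linked
        unlinked_linked_disjoint bij_betw_split_set) blast+
  finally show ?thesis .
qed

section \<open>Generating functions of the local choices\<close>

lemma sum_unlinked:
  fixes y :: "'a :: comm_semiring_1"
  assumes "S \<in> components R F"
  shows "(\<Sum>X\<in>unlinked S. y ^ card X) = (if ZeroBar \<in> S then 1 else 1 + of_nat (card S) * y)"
proof (cases "ZeroBar \<in> S")
  case False
  have "unlinked S = insert {} ((\<lambda>e. {e}) ` attached S)"
  proof (intro equalityI subsetI)
    fix X assume "X \<in> unlinked S"
    then have X: "X \<subseteq> attached S" "card X \<le> 1" using False by (auto simp: unlinked_def)
    have "finite X" using X finite_attached finite_subset by blast
    then have "X = {} \<or> (\<exists>e. X = {e})" using X(2) by (cases "card X") (auto simp: card_1_singleton_iff)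
    then show "X \<in> insert {} ((\<lambda>e. {e}) ` attached S)" using X by auto
  qed (use False in \<open>auto simp: unlinked_def\<close>)
  then show ?thesis
    using False finite_attached card_attached[OF assms] by (simp add: sum.insert_if image_iff sum.reindex)
qed (simp add: unlinked_def)

lemma card_attached_A: "card {u. EdgeA u \<in> attached S} = card (S \<inter> ZA)"
proof -
  have "S \<inter> ZA = Vertex ` {u. EdgeA u \<in> attached S}"
    by (auto simp: ZA_def attached_def T_eq)
  then show ?thesis by (simp add: card_image inj_on_def)
qed

lemma card_attached_B:
  assumes "S \<in> components R F" "ZeroBar \<notin> S"
  shows "card {v. EdgeB v \<in> attached S} = card (S - ZA)"
proof -
  have "S \<subseteq> verts R" using Union_components[OF finite_R F] assms(1) by auto
  then have "S - ZA \<subseteq> Vertex ` (B - A)"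
    using assms(2) by (auto simp: ZA_def verts_R AB[symmetric])
  moreover have "Vertex ` {u. EdgeB u \<in> attached S} = S \<inter> Vertex ` (B - A)"
    by (auto simp: attached_def T_eq)
  ultimately have "S - ZA = Vertex ` {u. EdgeB u \<in> attached S}"
    by (auto simp: ZA_def)
  then show ?thesis by (simp add: card_image inj_on_def)
qed

lemma sum_linked:
  fixes y :: "'a :: comm_semiring_1"
  assumes S: "S \<in> components R F"
  shows "(\<Sum>X\<in>linked S. y ^ card X) =
    (if ZeroBar \<in> S then (1 + of_nat (card (S \<inter> ZA))) * y
     else of_nat (card (S \<inter> ZA) * card (S - ZA)) * y\<^sup>2)"
proof (cases "ZeroBar \<in> S")
  case True
  have "{e \<in> attached S. \<forall>v. e \<noteq> EdgeB v} = insert ConeEdge (EdgeA ` {u. EdgeA u \<in> attached S})"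
    using True ConeEdge_attached by (auto elim: attached_cases)
  moreover have "finite {u. EdgeA u \<in> attached S}"
    by (rule finite_subset[OF _ finite_A]) (auto simp: attached_def T_eq)
  ultimately have "card {e \<in> attached S. \<forall>v. e \<noteq> EdgeB v} = 1 + card (S \<inter> ZA)"
    using card_attached_A[of S] by (auto simp: card_insert_if card_image inj_on_def)
  then show ?thesis using True by (simp add: linked_def sum.reindex)
next
  case False
  have "linked S = (\<lambda>(u, v). {EdgeA u, EdgeB v}) ` ({u. EdgeA u \<in> attached S} \<times> {v. EdgeB v \<in> attached S})"
    using False by (auto simp: linked_def)
  moreover have "inj_on (\<lambda>(u, v). {EdgeA u, EdgeB v :: ('v, 'e) bicone_edge}) P" for P
    by (auto simp: inj_on_def doubleton_eq_iff)
  ultimately have "card (linked S) = card (S \<inter> ZA) * card (S - ZA)"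
    using card_attached_A[of S] card_attached_B[OF S False] by (simp add: card_image card_cartesian_product)
  moreover have "(\<Sum>X\<in>linked S. y ^ card X) = (\<Sum>X\<in>linked S. y\<^sup>2)"
    using False by (intro sum.cong) (auto simp: linked_def power2_eq_square)
  ultimately show ?thesis using False by simp
qed

end


section \<open>Weighting a forest\<close>

text \<open>The power of \<open>r\<close> supplies one factor per index. The index \<open>k\<close>,
  later the component of \<open>ZeroBar\<close>, has \<open>p k = 1\<close> and leaves its
  \<open>r\<close> free: in the term special at \<open>i\<close>, this \<open>r\<close> joins that
  of \<open>i\<close> to give \<open>r\<^sup>2\<close>.\<close>

lemma scaled_at_most_one_special:
  fixes r :: "'a :: comm_semiring_1"
  assumes I: "finite I" "k \<in> I" and pk: "p k = 1"
  shows "r ^ card I * ((\<Prod>i\<in>I. p i) + (\<Sum>i\<in>I. q i * (\<Prod>j\<in>I - {i}. p j))) =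
    (r + r * q k) * (\<Prod>i\<in>I - {k}. r * p i) +
    (\<Sum>i\<in>I - {k}. r\<^sup>2 * q i * (\<Prod>j\<in>I - {k} - {i}. r * p j))"
proof -
  have scale: "(\<Prod>j\<in>J. r * p j) = r ^ card J * (\<Prod>j\<in>J. p j)" for J
    by (simp add: prod.distrib)
  have c: "card I = Suc (card (I - {k}))" using I by (rule card.remove)
  have "r ^ card I * (q i * (\<Prod>j\<in>I - {i}. p j)) = r\<^sup>2 * q i * (\<Prod>j\<in>I - {k} - {i}. r * p j)"
    if i: "i \<in> I - {k}" for i
  proof -
    have "card (I - {k}) = Suc (card (I - {k} - {i}))" using i I by (intro card.remove) auto
    moreover have "(\<Prod>j\<in>I - {i}. p j) = (\<Prod>j\<in>I - {k} - {i}. p j)"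
    proof -
      have "(\<Prod>j\<in>I - {i}. p j) = p k * (\<Prod>j\<in>I - {i} - {k}. p j)"
        using I i by (intro prod.remove) auto
      moreover have "I - {i} - {k} = I - {k} - {i}" by auto
      ultimately show ?thesis using pk by simp
    qed
    ultimately show ?thesis using c by (simp add: scale power2_eq_square mult_ac)
  qed
  then have "(\<Sum>i\<in>I - {k}. r ^ card I * (q i * (\<Prod>j\<in>I - {i}. p j))) =
      (\<Sum>i\<in>I - {k}. r\<^sup>2 * q i * (\<Prod>j\<in>I - {k} - {i}. r * p j))"
    by (rule sum.cong[OF refl])
  moreover have "(\<Prod>i\<in>I. p i) = (\<Prod>i\<in>I - {k}. p i)" using prod.remove[OF I, of p] pk by simp
  moreover have "(\<Sum>i\<in>I. q i * (\<Prod>j\<in>I - {i}. p j)) =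
      q k * (\<Prod>j\<in>I - {k}. p j) + (\<Sum>i\<in>I - {k}. q i * (\<Prod>j\<in>I - {i}. p j))"
    using I by (rule sum.remove)
  ultimately show ?thesis
    using c by (simp add: scale algebra_simps sum_distrib_left)
qed

context biconed_forest
begin

text \<open>The contribution of \<open>ZeroBar\<close> is left out, in contrast to
  \<open>excess_weight\<close>. The thresholds at the component of \<open>ZeroBar\<close> are
  therefore lower by one in the next two definitions.\<close>

definition excess :: "(('v, 'e) bicone_edge \<Rightarrow> nat) \<Rightarrow> 'v bicone_vertex set \<Rightarrow> nat" where
  "excess w S = (\<Sum>e\<in>component_edges R F S. w e - 1)"

definition light_weights :: "'v bicone_vertex set \<Rightarrow> (('v, 'e) bicone_edge \<Rightarrow> nat) set" where
  "light_weights S = {w \<in> component_edges R F S \<rightarrow>\<^sub>E {1..}.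
     excess w S \<le> (if ZeroBar \<in> S then 0 else 1)}"

definition heavy_weights :: "'v bicone_vertex set \<Rightarrow> (('v, 'e) bicone_edge \<Rightarrow> nat) set" where
  "heavy_weights S = {w \<in> component_edges R F S \<rightarrow>\<^sub>E {1..}.
     excess w S = (if ZeroBar \<in> S then 1 else 2) \<and>
     odd_shortest_path R F (crossing G A B) {e \<in> component_edges R F S. w e \<ge> 2}
       (if ZeroBar \<in> S then {ZeroBar} else {})}"

lemma finite_component_edges: "finite (component_edges R F S)"
  using finite_F by (simp add: component_edges_def)

lemma light_heavy_disjoint: "light_weights S \<inter> heavy_weights S = {}"
  by (auto simp: light_weights_def heavy_weights_def)

lemma light_heavy_subset:
  "light_weights S \<union> heavy_weights S \<subseteq> component_edges R F S \<rightarrow>\<^sub>E {1..}"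
  by (auto simp: light_weights_def heavy_weights_def)

lemma finite_light: "finite (light_weights S)"
  by (rule finite_subset[OF _ finite_bounded_excess_weights[OF finite_component_edges, of S 1]])
    (auto simp: light_weights_def excess_def split: if_splits)

lemma finite_heavy: "finite (heavy_weights S)"
  by (rule finite_subset[OF _ finite_bounded_excess_weights[OF finite_component_edges, of S 2]])
    (auto simp: heavy_weights_def excess_def split: if_splits)

lemma excess_restrict [simp]: "excess (restrict w (component_edges R F S)) S = excess w S"
  by (simp add: excess_def)

text \<open>All conditions but one concern single components, and the parity condition can be
  included in the meaning of heavy. What remains global is that at most one component is
  heavy.\<close>

lemma two_weighted_forest_iff_local:
  "two_weighted_forest G A B F w \<longleftrightarrow>
    w \<in> F \<rightarrow>\<^sub>E {1..} \<and>
    (\<forall>S\<in>components R F. restrict w (component_edges R F S) \<in> light_weights S \<union> heavy_weights S) \<and>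
    card {S \<in> components R F. restrict w (component_edges R F S) \<in> heavy_weights S} \<le> 1"
proof (cases "w \<in> F \<rightarrow>\<^sub>E {1..}")
  case True
  let ?C = "components R F"
  let ?P = "\<lambda>S. odd_shortest_path R F (crossing G A B) {e \<in> component_edges R F S. w e \<ge> 2}
    (if ZeroBar \<in> S then {ZeroBar} else {})"
  let ?ex = "excess_weight R F w"
  have ex: "?ex S = (if ZeroBar \<in> S then 1 else 0) + excess w S" for S
    by (simp add: excess_weight_def excess_def)
  have r: "restrict w (component_edges R F S) \<in> component_edges R F S \<rightarrow>\<^sub>E {1..}" for S
    using True by (auto simp: component_edges_def)
  have W: "{e \<in> component_edges R F S. restrict w (component_edges R F S) e \<ge> 2} =
      {e \<in> component_edges R F S. w e \<ge> 2}" for S by auto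
  have light: "restrict w (component_edges R F S) \<in> light_weights S \<longleftrightarrow> ?ex S \<le> 1" for S
    using r by (auto simp: light_weights_def ex)
  have heavy: "restrict w (component_edges R F S) \<in> heavy_weights S \<longleftrightarrow> ?ex S = 2 \<and> ?P S" for S
    using r[of S] unfolding heavy_weights_def mem_Collect_eq W excess_restrict ex
    by (cases "ZeroBar \<in> S") simp_all
  have "two_weighted_forest G A B F w \<longleftrightarrow> card {S \<in> ?C. ?ex S = 2} \<le> 1 \<and>
      (\<forall>S\<in>?C. ?ex S \<le> 1 \<or> ?ex S = 2) \<and> (\<forall>S\<in>?C. ?ex S = 2 \<longrightarrow> ?P S)"
  proof -
    have "(n \<noteq> 2 \<longrightarrow> n \<in> {0, 1}) \<longleftrightarrow> n \<le> 1 \<or> n = 2" for n :: nat by auto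
    then show ?thesis
      using True F acyclic_F
      by (auto simp: two_weighted_forest_def Let_def R_def[symmetric] odd_shortest_path_def weighted_edges_def)
  qed
  \<comment> \<open>Once every component of excess weight 2 satisfies the parity condition, counting
    those components and counting the heavy ones is the same.\<close>
  also have "\<dots> \<longleftrightarrow> (\<forall>S\<in>?C. ?ex S \<le> 1 \<or> (?ex S = 2 \<and> ?P S)) \<and>
      card {S \<in> ?C. ?ex S = 2 \<and> ?P S} \<le> 1"
  proof (cases "\<forall>S\<in>?C. ?ex S = 2 \<longrightarrow> ?P S")
    case True
    then have "{S \<in> ?C. ?ex S = 2 \<and> ?P S} = {S \<in> ?C. ?ex S = 2}" by blast
    then show ?thesis using True by auto
  next
    case False
    then obtain S where "S \<in> ?C" "?ex S = 2" "\<not> ?P S" by blast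
    then show ?thesis using False by fastforce
  qed
  finally show ?thesis using True by (simp add: light heavy)
qed (auto simp: two_weighted_forest_def Let_def)

lemma sum_excess: "(\<Sum>S\<in>components R F. excess w S) = (\<Sum>e\<in>F. w e - 1)"
proof -
  have "(\<Sum>e\<in>F. w e - 1) = (\<Sum>e\<in>(\<Union>S\<in>components R F. component_edges R F S). w e - 1)"
    using Union_component_edges[OF finite_R F] by simp
  also have "\<dots> = (\<Sum>S\<in>components R F. excess w S)"
    unfolding excess_def
    using finite_components[OF finite_verts] finite_component_edges component_edges_disjoint[OF finite_R F]
    by (intro sum.UNION_disjoint) auto
  finally show ?thesis by simp
qed

lemma sum_two_weighted_forests:
  fixes x :: "'a :: comm_semiring_1"
  shows "(\<Sum>w\<in>{w. two_weighted_forest G A B F w}. x ^ (\<Sum>e\<in>F. w e - 1)) =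
    (\<Prod>S\<in>components R F. \<Sum>w\<in>light_weights S. x ^ excess w S) +
    (\<Sum>S\<in>components R F. (\<Sum>w\<in>heavy_weights S. x ^ excess w S) *
      (\<Prod>S'\<in>components R F - {S}. \<Sum>w\<in>light_weights S'. x ^ excess w S'))"
proof -
  let ?C = "components R F"
  let ?D = "component_edges R F"
  let ?p = "\<lambda>w. \<lambda>S\<in>?C. restrict w (?D S)"
  let ?X = "{w \<in> (\<Union>S\<in>?C. ?D S) \<rightarrow>\<^sub>E {1..}. \<forall>S\<in>?C. restrict w (?D S) \<in> light_weights S \<union> heavy_weights S}"
  have fin: "finite ?C" using finite_components[OF finite_verts] .
  have "{S \<in> ?C. ?p w S \<in> heavy_weights S} = {S \<in> ?C. restrict w (?D S) \<in> heavy_weights S}" for w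
    by auto
  then have "{w. two_weighted_forest G A B F w} = {w \<in> ?X. card {S \<in> ?C. ?p w S \<in> heavy_weights S} \<le> 1}"
    unfolding two_weighted_forest_iff_local Union_component_edges[OF finite_R F] by auto
  moreover have "x ^ (\<Sum>e\<in>F. w e - 1) = (\<Prod>S\<in>?C. x ^ excess (?p w S) S)" for w
    by (simp only: sum_excess[symmetric] power_sum) (auto intro!: prod.cong)
  ultimately have "(\<Sum>w\<in>{w. two_weighted_forest G A B F w}. x ^ (\<Sum>e\<in>F. w e - 1)) =
      (\<Sum>w\<in>{w \<in> ?X. card {S \<in> ?C. ?p w S \<in> heavy_weights S} \<le> 1}. \<Prod>S\<in>?C. x ^ excess (?p w S) S)"
    by simp
  also have "\<dots> = (\<Prod>S\<in>?C. \<Sum>w\<in>light_weights S. x ^ excess w S) +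
      (\<Sum>S\<in>?C. (\<Sum>w\<in>heavy_weights S. x ^ excess w S) * (\<Prod>S'\<in>?C - {S}. \<Sum>w\<in>light_weights S'. x ^ excess w S'))"
    using component_edges_disjoint[OF finite_R F] light_heavy_subset
    by (intro sum_at_most_one_special[where f = "\<lambda>S w. x ^ excess w S"] fin finite_light finite_heavy
        light_heavy_disjoint bij_betw_split_function) blast+
  finally show ?thesis .
qed

lemma sum_light_weights:
  fixes x :: "'a :: comm_semiring_1"
  shows "(\<Sum>w\<in>light_weights S. x ^ excess w S) =
    (if ZeroBar \<in> S then 1 else 1 + of_nat (card (component_edges R F S)) * x)"
proof (cases "ZeroBar \<in> S")
  case True
  have "{l. set l \<subseteq> component_edges R F S \<and> length l \<le> 0} = {[]}" by auto
  then have "light_weights S = {list_weight (component_edges R F S) []}"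
    using bounded_excess_weights_eq[OF finite_component_edges, of S 0] True
    by (simp add: light_weights_def excess_def)
  then show ?thesis
    using True list_weight_props(2)[OF finite_component_edges, of "[]" S] by (simp add: excess_def)
next
  case False
  then show ?thesis
    using sum_normal_weights[OF finite_component_edges, where x = x and S1 = S]
    by (simp add: light_weights_def excess_def)
qed

lemma sum_heavy_weights:
  fixes x :: "'a :: comm_semiring_1"
  assumes S: "S \<in> components R F"
  shows "(\<Sum>w\<in>heavy_weights S. x ^ excess w S) =
    (if ZeroBar \<in> S then of_nat (card (S \<inter> ZA)) * x
     else of_nat (card (S \<inter> ZA) * card (S - ZA)) * x\<^sup>2)"
proof -
  have cr: "crossing G A B e \<longleftrightarrow> (u \<in> ZA) \<noteq> (v \<in> ZA)" if "e \<in> F" "ends R e = {u, v}" for e u v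
    using crossing_iff that F by blast
  have "card (heavy_weights S) =
      (if ZeroBar \<in> S then card (S \<inter> ZA) else card (S \<inter> ZA) * card (S - ZA))"
  proof (cases "ZeroBar \<in> S")
    case True
    have "ZeroBar \<notin> ZA" by (auto simp: ZA_def)
    then show ?thesis
      using card_special_weights_rooted[where cross = "crossing G A B" and Z = ZA, OF S True _ cr] True
      by (simp add: heavy_weights_def excess_def)
  next
    case False
    then show ?thesis
      using card_special_weights[where cross = "crossing G A B" and Z = ZA, OF S cr]
      by (simp add: heavy_weights_def excess_def)
  qed
  moreover have "(\<Sum>w\<in>heavy_weights S. x ^ excess w S) =
      (\<Sum>w\<in>heavy_weights S. if ZeroBar \<in> S then x else x\<^sup>2)"
    by (intro sum.cong) (auto simp: heavy_weights_def)
  ultimately show ?thesis by simp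
qed

text \<open>Every component has excess weight at most 1, except for one that may have 2. The sum
  exceeds the number of components by at most 1, and \<open>ZeroBar\<close> accounts for 1 of it. So
  the exponents below are not truncated.\<close>

lemma excess_bound:
  assumes "two_weighted_forest G A B F w"
  shows "(\<Sum>e\<in>F. w e - 1) \<le> card (components R F)"
proof -
  let ?C = "components R F"
  have fin: "finite ?C" using finite_components[OF finite_verts] .
  obtain S0 where S0: "S0 \<in> ?C" "ZeroBar \<in> S0"
    using component_of_vertex[OF ZeroBar_R] by blast
  \<comment> \<open>The extra 1 is the contribution of \<open>ZeroBar\<close>, credited to its
    component \<open>S0\<close>.\<close>
  have "1 + (\<Sum>e\<in>F. w e - 1) = (\<Sum>S\<in>?C. if S = S0 then 1 else 0) + (\<Sum>S\<in>?C. excess w S)"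
    using fin S0 by (simp add: sum_excess sum.delta)
  also have "\<dots> = (\<Sum>S\<in>?C. (if S = S0 then 1 else 0) + excess w S)" by (simp add: sum.distrib)
  also have "\<dots> \<le> (\<Sum>S\<in>?C. 1 + (if restrict w (component_edges R F S) \<in> heavy_weights S then 1 else 0))"
  proof (rule sum_mono)
    fix S assume S: "S \<in> ?C"
    then have "S = S0 \<longleftrightarrow> ZeroBar \<in> S" using S0 components_disjoint by metis
    moreover have "restrict w (component_edges R F S) \<in> light_weights S \<union> heavy_weights S"
      using assms S unfolding two_weighted_forest_iff_local by blast
    moreover have "excess w S \<le> (if ZeroBar \<in> S then 0 else 1)"
      if "restrict w (component_edges R F S) \<in> light_weights S"
      using that unfolding light_weights_def mem_Collect_eq excess_restrict by blast
    moreover have "excess w S = (if ZeroBar \<in> S then 1 else 2)"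
      if "restrict w (component_edges R F S) \<in> heavy_weights S"
      using that unfolding heavy_weights_def mem_Collect_eq excess_restrict by blast
    ultimately show "(if S = S0 then 1 else 0) + excess w S \<le>
        1 + (if restrict w (component_edges R F S) \<in> heavy_weights S then 1 else 0)"
      by (cases "restrict w (component_edges R F S) \<in> heavy_weights S") auto
  qed
  also have "\<dots> = card ?C + card {S \<in> ?C. restrict w (component_edges R F S) \<in> heavy_weights S}"
    using fin by (simp add: sum_Suc sum.If_cases Int_def)
  also have "\<dots> \<le> card ?C + 1"
    using assms unfolding two_weighted_forest_iff_local by simp
  finally show ?thesis by simp
qed

lemma forest_degree_eq:
  assumes "two_weighted_forest G A B F w"
  shows "forest_degree F w = card F + (\<Sum>e\<in>F. w e - 1)"
proof -
  have "w e = 1 + (w e - 1)" if "e \<in> F" for e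
    using assms that by (fastforce simp: two_weighted_forest_iff_local PiE_iff)
  then have "(\<Sum>e\<in>F. w e) = (\<Sum>e\<in>F. 1 + (w e - 1))" by (rule sum.cong[OF refl])
  then show ?thesis by (simp only: forest_degree_def sum.distrib) simp
qed

lemma finite_two_weighted_forests: "finite {w. two_weighted_forest G A B F w}"
proof (rule finite_subset)
  show "{w. two_weighted_forest G A B F w} \<subseteq>
      {w \<in> F \<rightarrow>\<^sub>E {1..}. (\<Sum>e\<in>F. w e - 1) \<le> card (components R F)}"
    using excess_bound by (auto simp: two_weighted_forest_iff_local)
qed (rule finite_bounded_excess_weights[OF finite_F])

text \<open>Here \<open>y\<close> and \<open>x\<close> are the inverses of \<open>s\<close> and
  \<open>t\<close>. After scaling, both sides have the same ingredients: \<open>g S\<close> for a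
  normal and \<open>b S\<close> for a special ordinary component, and \<open>t + a\<close> for that
  of \<open>ZeroBar\<close>.\<close>

lemma extensions_eq_weightings:
  fixes s t x y :: "'a :: comm_semiring_1"
  assumes s: "s * y = 1" and t: "t * x = 1" "t = s + 1"
  shows "s ^ card (components R F) * (\<Sum>X\<in>{X. X \<subseteq> T \<and> acyclic_edges H (F \<union> X)}. y ^ card X) =
    t ^ card (components R F) * (\<Sum>w\<in>{w. two_weighted_forest G A B F w}. x ^ (\<Sum>e\<in>F. w e - 1))"
proof -
  let ?C = "components R F"
  have sc: "s * (c * y) = c" "s\<^sup>2 * (c * y\<^sup>2) = c" "t * (c * x) = c" "t\<^sup>2 * (c * x\<^sup>2) = c" for c
    using s t(1) by (simp_all add: mult.left_commute flip: power_mult_distrib)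
  have fin: "finite ?C" using finite_components[OF finite_verts] .
  obtain S0 where S0: "S0 \<in> ?C" "ZeroBar \<in> S0"
    using component_of_vertex[OF ZeroBar_R] by blast
  have nZ: "ZeroBar \<notin> S" if "S \<in> ?C - {S0}" for S
    using that S0 components_disjoint by fast
  define g :: "'v bicone_vertex set \<Rightarrow> 'a" where "g S = s + of_nat (card S)" for S
  define a :: 'a where "a = of_nat (card (S0 \<inter> ZA))"
  define b :: "'v bicone_vertex set \<Rightarrow> 'a" where "b S = of_nat (card (S \<inter> ZA) * card (S - ZA))" for S
  have gs: "s * (\<Sum>X\<in>unlinked S. y ^ card X) = g S" if "S \<in> ?C - {S0}" for S
    using that nZ[OF that] by (simp add: sum_unlinked g_def distrib_left sc)
  have gt: "t * (\<Sum>w\<in>light_weights S. x ^ excess w S) = g S" if "S \<in> ?C - {S0}" for S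
  proof -
    \<comment> \<open>The vertex in excess of the edges makes up for the difference between
      \<open>s\<close> and \<open>t\<close>.\<close>
    have "card S = Suc (card (component_edges R F S))"
      using card_component_edges[of S] that by simp
    moreover have "t * (\<Sum>w\<in>light_weights S. x ^ excess w S) = t + of_nat (card (component_edges R F S))"
      using nZ[OF that] by (simp add: sum_light_weights distrib_left sc)
    ultimately show ?thesis by (simp add: g_def t(2) add.assoc)
  qed
  have bs: "s\<^sup>2 * (\<Sum>X\<in>linked S. y ^ card X) = b S" if "S \<in> ?C - {S0}" for S
    using that nZ[OF that] by (simp add: sum_linked b_def sc)
  have bt: "t\<^sup>2 * (\<Sum>w\<in>heavy_weights S. x ^ excess w S) = b S" if "S \<in> ?C - {S0}" for S
    using that nZ[OF that] by (simp add: sum_heavy_weights b_def sc)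
  have "s ^ card ?C * (\<Sum>X\<in>{X. X \<subseteq> T \<and> acyclic_edges H (F \<union> X)}. y ^ card X) =
      (s + s * (\<Sum>X\<in>linked S0. y ^ card X)) * (\<Prod>S\<in>?C - {S0}. g S) +
      (\<Sum>S\<in>?C - {S0}. b S * (\<Prod>S'\<in>?C - {S0} - {S}. g S'))"
    unfolding sum_acyclic_extensions
    by (subst scaled_at_most_one_special[OF fin S0(1)]) (use S0 in \<open>simp_all add: sum_unlinked[OF S0(1)] gs bs\<close>)
  \<comment> \<open>The link \<open>ConeEdge\<close> contributes the 1 that turns \<open>s\<close>
    into \<open>t\<close>.\<close>
  also have "s + s * (\<Sum>X\<in>linked S0. y ^ card X) = t + a"
    using S0 by (simp add: sum_linked a_def sc t(2) add.assoc)
  also have "t + a = t + t * (\<Sum>w\<in>heavy_weights S0. x ^ excess w S0)"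
    using S0 by (simp add: sum_heavy_weights a_def sc)
  also have "(t + t * (\<Sum>w\<in>heavy_weights S0. x ^ excess w S0)) * (\<Prod>S\<in>?C - {S0}. g S) +
      (\<Sum>S\<in>?C - {S0}. b S * (\<Prod>S'\<in>?C - {S0} - {S}. g S')) =
      t ^ card ?C * (\<Sum>w\<in>{w. two_weighted_forest G A B F w}. x ^ (\<Sum>e\<in>F. w e - 1))"
    unfolding sum_two_weighted_forests
    by (subst scaled_at_most_one_special[OF fin S0(1)]) (use S0 in \<open>simp_all add: sum_light_weights[where S = S0] gt bt\<close>)
  finally show ?thesis .
qed

end


section \<open>The h-polynomial\<close>

context biconed
begin

section \<open>Independent sets and the rank\<close>

definition forests :: "('v, 'e) bicone_edge set set" where
  "forests = {F. F \<subseteq> edges R \<and> acyclic_edges R F}"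

lemma biconed_forestI: "F \<in> forests \<Longrightarrow> biconed_forest G A B F"
  by unfold_locales (auto simp: forests_def)

lemma finite_forests: "finite forests"
  by (rule finite_subset[of _ "Pow (edges R)"]) (use finite_R in \<open>auto simp: forests_def finite_multigraph_def\<close>)

lemma card_verts_H: "card (verts H) = Suc (card (verts R))"
proof -
  have "verts H = insert Zero (verts R)" by (auto simp: verts_H verts_R)
  then show ?thesis using Zero_R finite_R by (simp add: finite_multigraph_def)
qed

lemma card_indep_le:
  assumes "I \<in> graphic_matroid H"
  shows "card I \<le> card (verts R)"
proof -
  interpret I: forest H I
    using assms finite_H by unfold_locales (auto simp: graphic_matroid_def)
  have "components H I \<noteq> {}"
    using component_of_vertex[of ZeroBar H I] by (auto simp: verts_H)
  then have "card (components H I) \<noteq> 0" using finite_components[OF I.finite_verts] by simp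
  then show ?thesis using I.card_forest card_verts_H by linarith
qed

lemma finite_matroid: "finite (graphic_matroid H)"
  by (rule finite_subset[of _ "Pow (edges H)"])
    (use finite_H in \<open>auto simp: graphic_matroid_def finite_multigraph_def\<close>)

text \<open>Over the empty forest every component is a single vertex. As \<open>EdgeA\<close> and
  \<open>EdgeB\<close> in \<open>T\<close> belong to disjoint vertex sets, \<open>ConeEdge\<close>
  is the only link.\<close>

lemma T_indep: "T \<in> graphic_matroid H"
proof -
  interpret E: biconed_forest G A B "{}"
    by unfold_locales (auto simp: acyclic_edges_def is_cycle_def)
  have "E.one_link T"
    by (auto simp: E.one_link_def E.link_def adjacency_empty T_eq)
  then have "acyclic_edges H T" using E.acyclic_iff_one_link[of T] by simp
  then show ?thesis by (auto simp: graphic_matroid_def edges_H)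
qed

lemma rank_H: "matroid_rank (graphic_matroid H) = card (verts R)"
  unfolding matroid_rank_def
  using finite_matroid card_indep_le T_indep card_T by (intro Max_eqI) (auto intro: image_eqI[where x = T])

lemma card_forest_components: "F \<in> forests \<Longrightarrow> card F + card (components R F) = card (verts R)"
proof -
  assume "F \<in> forests"
  then interpret biconed_forest G A B F by (rule biconed_forestI)
  show ?thesis by (rule card_forest)
qed

lemma sum_indep_split:
  "(\<Sum>I\<in>graphic_matroid H. f I) =
    (\<Sum>F\<in>forests. \<Sum>X\<in>{X. X \<subseteq> T \<and> acyclic_edges H (F \<union> X)}. f (F \<union> X))"
proof -
  let ?E = "\<lambda>F. {X. X \<subseteq> T \<and> acyclic_edges H (F \<union> X)}"
  have "(\<Sum>F\<in>forests. \<Sum>X\<in>?E F. f (F \<union> X)) = (\<Sum>(F, X)\<in>Sigma forests ?E. f (F \<union> X))"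
    using finite_forests finite_T by (intro sum.Sigma) auto
  also have "\<dots> = (\<Sum>I\<in>graphic_matroid H. f I)"
  proof (rule sum.reindex_bij_witness[where i = "\<lambda>I. (I \<inter> edges R, I \<inter> T)" and j = "\<lambda>(F, X). F \<union> X"])
    fix I assume I: "I \<in> graphic_matroid H"
    then have eq: "I \<inter> edges R \<union> I \<inter> T = I" by (auto simp: graphic_matroid_def edges_H)
    show "(case (I \<inter> edges R, I \<inter> T) of (F, X) \<Rightarrow> F \<union> X) = I" using eq by simp
    have "acyclic_edges H (I \<inter> edges R)"
      using I by (auto simp: graphic_matroid_def intro: acyclic_edges_mono)
    then show "(I \<inter> edges R, I \<inter> T) \<in> Sigma forests ?E"
      using I eq acyclic_H_iff_R[of "I \<inter> edges R"] by (auto simp: forests_def graphic_matroid_def)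
  next
    fix p assume "p \<in> Sigma forests ?E"
    then obtain F X where p: "p = (F, X)" "F \<subseteq> edges R" "X \<subseteq> T" "acyclic_edges H (F \<union> X)"
      by (auto simp: forests_def)
    then show "(case p of (F, X) \<Rightarrow> F \<union> X) \<in> graphic_matroid H"
      by (auto simp: graphic_matroid_def edges_H)
    have "(F \<union> X) \<inter> edges R = F" "(F \<union> X) \<inter> T = X"
      using p T_disjoint by blast+
    then show "((case p of (F, X) \<Rightarrow> F \<union> X) \<inter> edges R, (case p of (F, X) \<Rightarrow> F \<union> X) \<inter> T) = p"
      using p(1) by simp
  qed auto
  finally show ?thesis by simp
qed

text \<open>Grouping the independent sets by size turns the value of the h-polynomial into a sum
  over them. Real numbers are used so that the powers can be divided later.\<close>

lemma poly_h_polynomial: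
  "of_int (poly (h_polynomial (graphic_matroid H)) k) =
    (\<Sum>I\<in>graphic_matroid H. (of_int k - 1 :: real) ^ (card (verts R) - card I))"
proof -
  let ?M = "graphic_matroid H" and ?d = "card (verts R)"
  let ?f = "\<lambda>i. (of_int k - 1 :: real) ^ (?d - i)"
  have "(\<Sum>I\<in>?M. ?f (card I)) = (\<Sum>i\<le>?d. \<Sum>I\<in>{I \<in> ?M. card I = i}. ?f (card I))"
    using finite_matroid card_indep_le by (intro sum.group[symmetric]) auto
  also have "\<dots> = (\<Sum>i\<le>?d. of_nat (num_indep ?M i) * ?f i)"
    by (intro sum.cong) (simp_all add: num_indep_def)
  finally show ?thesis
    by (simp add: h_polynomial_def rank_H poly_sum poly_monom of_nat_poly)
qed

lemma two_weighted_forest_imp_forests: "two_weighted_forest G A B F w \<Longrightarrow> F \<in> forests"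
  by (auto simp: two_weighted_forest_def Let_def forests_def R_def)

lemma forest_degree_le:
  assumes "two_weighted_forest G A B F w"
  shows "forest_degree F w \<le> card (verts R)"
proof -
  have in_forests: "F \<in> forests" using assms by (rule two_weighted_forest_imp_forests)
  then interpret biconed_forest G A B F by (rule biconed_forestI)
  show ?thesis
    using forest_degree_eq[OF assms] excess_bound[OF assms] card_forest_components[OF in_forests] by linarith
qed

lemma finite_pairs: "finite {(F, w). two_weighted_forest G A B F w}"
proof -
  have "finite {w. two_weighted_forest G A B F w}" if "F \<in> forests" for F
  proof -
    interpret biconed_forest G A B F using that by (rule biconed_forestI)
    show ?thesis by (rule finite_two_weighted_forests)
  qed
  moreover have "{(F, w). two_weighted_forest G A B F w} =
      Sigma forests (\<lambda>F. {w. two_weighted_forest G A B F w})"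
    using two_weighted_forest_imp_forests by auto
  ultimately show ?thesis using finite_forests by simp
qed

text \<open>The values agree at every integer \<open>k \<ge> 2\<close>, where \<open>k - 1\<close>
  and \<open>k\<close> are both nonzero and thus invertible in the reals. Infinitely many common
  values force equality.\<close>

lemma h_polynomial_eq:
  "h_polynomial (graphic_matroid H) =
    (\<Sum>(F, w)\<in>{(F, w). two_weighted_forest G A B F w}. monom 1 (card (verts R) - forest_degree F w))"
    (is "?p = ?q")
proof -
  let ?d = "card (verts R)"
  let ?W = "\<lambda>F. {w. two_weighted_forest G A B F w}"
  let ?E = "\<lambda>F. {X. X \<subseteq> T \<and> acyclic_edges H (F \<union> X)}"
  have Sig: "{(F, w). two_weighted_forest G A B F w} = Sigma forests ?W"
    using two_weighted_forest_imp_forests by auto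
  have "poly ?p k = poly ?q k" if k: "k \<ge> 2" for k :: int
  proof -
    define s t where "s = (of_int k - 1 :: real)" and "t = (of_int k :: real)"
    have st: "s * (1 / s) = 1" "t * (1 / t) = 1" "t = s + 1" "s \<noteq> 0" "t \<noteq> 0"
      using k by (auto simp: s_def t_def)
    have split_power: "r ^ (n - j) = r ^ n * (1 / r) ^ j" if "r \<noteq> 0" "j \<le> n" for r :: real and j n
      using that by (simp add: power_diff power_one_over)
    have "of_int (poly ?p k) = (\<Sum>F\<in>forests. \<Sum>X\<in>?E F. s ^ (?d - card (F \<union> X)))"
      unfolding poly_h_polynomial sum_indep_split s_def by simp
    also have "\<dots> = (\<Sum>F\<in>forests. \<Sum>w\<in>?W F. t ^ (?d - forest_degree F w))"
    proof (rule sum.cong[OF refl])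
      fix F assume in_forests: "F \<in> forests"
      then interpret biconed_forest G A B F by (rule biconed_forestI)
      let ?c = "card (components R F)"
      have c: "card F + ?c = ?d" using card_forest_components[OF in_forests] .
      \<comment> \<open>The exponent is the number of components of \<open>F\<close> minus
        \<open>card X\<close>, because \<open>F\<close> has rank minus that number of edges.\<close>
      have "(\<Sum>X\<in>?E F. s ^ (?d - card (F \<union> X))) = (\<Sum>X\<in>?E F. s ^ ?c * (1 / s) ^ card X)"
      proof (rule sum.cong[OF refl])
        fix X assume X: "X \<in> ?E F"
        have "F \<union> X \<in> graphic_matroid H" "finite X" "F \<inter> X = {}"
          using X finite_T T_disjoint F finite_subset
          by (auto simp: graphic_matroid_def edges_H)
        then have "card (F \<union> X) = card F + card X" "card (F \<union> X) \<le> ?d"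
          using card_indep_le[of "F \<union> X"] finite_F card_Un_disjoint[of F X] by simp_all
        then have "?d - card (F \<union> X) = ?c - card X" "card X \<le> ?c" using c by linarith+
        then show "s ^ (?d - card (F \<union> X)) = s ^ ?c * (1 / s) ^ card X"
          using split_power[OF st(4)] by simp
      qed
      also have "\<dots> = s ^ ?c * (\<Sum>X\<in>?E F. (1 / s) ^ card X)" by (rule sum_distrib_left[symmetric])
      also have "\<dots> = t ^ ?c * (\<Sum>w\<in>?W F. (1 / t) ^ (\<Sum>e\<in>F. w e - 1))"
        by (rule extensions_eq_weightings[OF st(1-3)])
      also have "\<dots> = (\<Sum>w\<in>?W F. t ^ ?c * (1 / t) ^ (\<Sum>e\<in>F. w e - 1))" by (rule sum_distrib_left)
      also have "\<dots> = (\<Sum>w\<in>?W F. t ^ (?d - forest_degree F w))"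
      proof (rule sum.cong[OF refl])
        fix w assume "w \<in> ?W F"
        then have w: "two_weighted_forest G A B F w" by simp
        have "?d - forest_degree F w = ?c - (\<Sum>e\<in>F. w e - 1)"
          using forest_degree_eq[OF w] c by linarith
        then show "t ^ ?c * (1 / t) ^ (\<Sum>e\<in>F. w e - 1) = t ^ (?d - forest_degree F w)"
          using split_power[OF st(5) excess_bound[OF w]] by simp
      qed
      finally show "(\<Sum>X\<in>?E F. s ^ (?d - card (F \<union> X))) = (\<Sum>w\<in>?W F. t ^ (?d - forest_degree F w))" .
    qed
    also have "\<dots> = (\<Sum>(F, w)\<in>Sigma forests ?W. t ^ (?d - forest_degree F w))"
    proof (rule sum.Sigma[OF finite_forests], rule ballI)
      fix F assume "F \<in> forests"
      then interpret biconed_forest G A B F by (rule biconed_forestI)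
      show "finite (?W F)" by (rule finite_two_weighted_forests)
    qed
    also have "\<dots> = of_int (poly ?q k)"
      unfolding Sig by (simp add: poly_sum poly_monom t_def case_prod_unfold)
    finally show ?thesis by simp
  qed
  \<comment> \<open>A nonzero polynomial would have finitely many roots.\<close>
  then have "{2..} \<subseteq> {k. poly (?p - ?q) k = 0}" by auto
  then have "infinite {k. poly (?p - ?q) k = 0}"
    using infinite_Ici finite_subset by blast
  then show ?thesis using poly_roots_finite[of "?p - ?q"] by auto
qed

lemma h_vector_eq:
  assumes "i \<le> card (verts R)"
  shows "h_vector (graphic_matroid H) i =
    int (card {(F, w). two_weighted_forest G A B F w \<and> forest_degree F w = i})"
proof -
  let ?P = "{(F, w). two_weighted_forest G A B F w}" and ?d = "card (verts R)"
  have "h_vector (graphic_matroid H) i = (\<Sum>p\<in>?P. if forest_degree (fst p) (snd p) = i then 1 else 0)"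
    unfolding h_vector_def rank_H h_polynomial_eq coeff_sum
  proof (rule sum.cong[OF refl])
    fix p assume "p \<in> ?P"
    then have "forest_degree (fst p) (snd p) \<le> ?d" using forest_degree_le by auto
    \<comment> \<open>Both degrees are at most the rank, so the subtraction of natural numbers is
      injective here.\<close>
    then have "?d - forest_degree (fst p) (snd p) = ?d - i \<longleftrightarrow> forest_degree (fst p) (snd p) = i"
      using assms by linarith
    then show "coeff (case p of (F, w) \<Rightarrow> monom 1 (?d - forest_degree F w)) (?d - i) =
        (if forest_degree (fst p) (snd p) = i then 1 else 0 :: int)"
      by (simp add: case_prod_unfold)
  qed
  also have "\<dots> = int (card (?P \<inter> {p. forest_degree (fst p) (snd p) = i}))"
    using finite_pairs by (simp add: sum.If_cases)
  also have "?P \<inter> {p. forest_degree (fst p) (snd p) = i} =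
      {(F, w). two_weighted_forest G A B F w \<and> forest_degree F w = i}" by auto
  finally show ?thesis .
qed

end

theorem theorem1p2:
  fixes G :: "('v, 'e) multigraph" and A B :: "'v set" and d :: nat
  assumes "finite_multigraph G"
    and "A \<subseteq> verts G" and "B \<subseteq> verts G" and "A \<union> B = verts G"
    and "d = card (verts (biconing G A B)) - 1"
  shows "matroid_rank (graphic_matroid (biconing G A B)) = d \<and>
    (\<forall>i\<le>d. h_vector (graphic_matroid (biconing G A B)) i =
       int (card {(F, w). two_weighted_forest G A B F w \<and> forest_degree F w = i}))"
proof -
  interpret biconed G A B using assms(1-4) by unfold_locales
  \<comment> \<open>The vertex subtracted in \<open>d\<close> is \<open>Zero\<close>, the only one
    missing from the reduced graph.\<close>
  have "d = card (verts R)" using assms(5) card_verts_H by (simp add: H_def)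
  then show ?thesis using rank_H h_vector_eq by (simp add: H_def)
qed

end
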